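(* Consider the FedAvg algorithm (full client participation, $h\ge 1$ local gradient steps with learning rate $\rho_F>0$, uniform averaging; see context) applied to the least-squares (quadratic) problem $\min_{\beta\in\mathbb{R}^p} F(\beta)=\sum_{i=1}^b f_i(\beta)$, $f_i(\beta)=\tfrac12\|X_i\beta-y_i\|_2^2$. Let the global Hessian $\nabla^2F(\beta^* )=\bar H$ be positive definite, let the local Hessians satisfy $\nabla^2 f_i(\beta^* )=\gamma_i\bar H$ for $i=1,\dots,b$ with $\sum_{i=1}^b\gamma_i=1$, and assume $\rho_F<\frac{1}{\lambda_{\max}(\bar H)}$. Then the linear mapping of FedAvg (the linear part of the affine map sending the stacked vector $\mathbf 1_b\otimes\beta^t$ to $\mathbf 1_b\otimes\beta^{t+1}$) can be represented as $$M_F=P\,(I-\rho_F\,\Gamma\otimes\bar H)^h,$$ where $P=\frac1b\mathbf 1_b\mathbf 1_b^\top\otimes I_p$ and $\Gamma=\mathrm{diag}(\gamma_1,\dots,\gamma_b)$. FedAvg converges, with spectral radius $\rho(M_F)<1$. Moreover, with the local variation $$\sigma:=\sum_{i=1}^b\Big\|\nabla^2 f_i(\beta^* )-\tfrac1b\nabla^2F(\beta^* )\Big\|,$$ for fixed $b$, $h$, $\rho_F$ and $\bar H$, the spectral radius $\rho(M_F)$ attains its minimum at $\sigma=0$.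
   Context: There are $b$ agents; agent $i$ holds data $X_i\in\mathbb{R}^{s_i\times p}$, $y_i\in\mathbb{R}^{s_i}$. $\beta^*$ is the minimizer of $F$. FedAvg with full participation: given the global iterate $\beta^t$, each agent $i$ sets $\beta_i^{t,0}=\beta^t$ and performs $\beta_i^{t,m+1}=\beta_i^{t,m}-\rho_F\nabla f_i(\beta_i^{t,m})$ for $m=0,\dots,h-1$; then the server sets $\beta^{t+1}=\frac1b\sum_{i=1}^b\beta_i^{t,h}$. $\rho(\cdot)$ is the spectral radius, $\mathbf 1_b$ the all-ones vector of length $b$, $\otimes$ the Kronecker product, $\lambda_{\max}$ the largest eigenvalue, and $\|\cdot\|$ a fixed matrix norm. *)

theory Defs
  imports "HOL-Analysis.Analysis" "Jordan_Normal_Form.Spectral_Radius"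
begin

unbundle no vec_syntax and no inner_syntax

text \<open>Linear algebra\<close>

definition ones_vec :: "nat \<Rightarrow> real vec" where
  "ones_vec n = vec n (\<lambda>_. 1)"

definition kron_vec :: "real vec \<Rightarrow> real vec \<Rightarrow> real vec" where
  "kron_vec u v = vec (dim_vec u * dim_vec v) (\<lambda>k. u $ (k div dim_vec v) * v $ (k mod dim_vec v))"

definition kron_mat :: "real mat \<Rightarrow> real mat \<Rightarrow> real mat" where
  "kron_mat A B = mat (dim_row A * dim_row B) (dim_col A * dim_col B)
     (\<lambda>(k, l). A $$ (k div dim_row B, l div dim_col B) * B $$ (k mod dim_row B, l mod dim_col B))"

definition pos_def_mat :: "nat \<Rightarrow> real mat \<Rightarrow> bool" where
  "pos_def_mat n A \<longleftrightarrow> A \<in> carrier_mat n n \<and> transpose_mat A = A \<and>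
     (\<forall>v \<in> carrier_vec n. v \<noteq> 0\<^sub>v n \<longrightarrow> 0 < v \<bullet> (A *\<^sub>v v))"

text \<open>The largest (real) eigenvalue, meaningful for symmetric matrices of positive dimension.\<close>

definition lambda_max :: "real mat \<Rightarrow> real" where
  "lambda_max A = Max (spectrum A)"

definition real_spectral_radius :: "real mat \<Rightarrow> real" where
  "real_spectral_radius A = spectral_radius (map_mat complex_of_real A)"

text \<open>No submultiplicativity is required, so this covers every convention for ``matrix norm''.\<close>

definition is_matrix_norm :: "nat \<Rightarrow> (real mat \<Rightarrow> real) \<Rightarrow> bool" where
  "is_matrix_norm n N \<longleftrightarrow>
     (\<forall>A \<in> carrier_mat n n. 0 \<le> N A \<and> (N A = 0 \<longleftrightarrow> A = 0\<^sub>m n n)) \<and>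
     (\<forall>A \<in> carrier_mat n n. \<forall>c. N (c \<cdot>\<^sub>m A) = \<bar>c\<bar> * N A) \<and>
     (\<forall>A \<in> carrier_mat n n. \<forall>B \<in> carrier_mat n n. N (A + B) \<le> N A + N B)"

text \<open>Gradient and Hessian of a function on \<open>\<real>\<^sup>n\<close>, through (second) partial derivatives\<close>

definition gradient :: "nat \<Rightarrow> (real vec \<Rightarrow> real) \<Rightarrow> real vec \<Rightarrow> real vec" where
  "gradient n f x = vec n (\<lambda>j. deriv (\<lambda>t. f (x + t \<cdot>\<^sub>v unit_vec n j)) 0)"

definition hessian :: "nat \<Rightarrow> (real vec \<Rightarrow> real) \<Rightarrow> real vec \<Rightarrow> real mat" where
  "hessian n f x = mat n n (\<lambda>(i, j). deriv (\<lambda>t. gradient n f (x + t \<cdot>\<^sub>v unit_vec n i) $ j) 0)"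

text \<open>Distributed least squares; agents are numbered \<open>0, \<dots>, b - 1\<close>.\<close>

definition local_loss :: "(nat \<Rightarrow> real mat) \<Rightarrow> (nat \<Rightarrow> real vec) \<Rightarrow> nat \<Rightarrow> real vec \<Rightarrow> real" where
  "local_loss X y i \<beta> = 1 / 2 * ((X i *\<^sub>v \<beta> - y i) \<bullet> (X i *\<^sub>v \<beta> - y i))"

definition global_loss :: "nat \<Rightarrow> (nat \<Rightarrow> real mat) \<Rightarrow> (nat \<Rightarrow> real vec) \<Rightarrow> real vec \<Rightarrow> real" where
  "global_loss b X y \<beta> = (\<Sum>i<b. local_loss X y i \<beta>)"

text \<open>
  Data \<open>X\<close>, \<open>y\<close> of \<open>b\<close> agents with sample sizes \<open>s\<close>, whose global loss has minimizer \<open>\<beta>\<^sub>*\<close>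
  and Hessian \<open>H\<close>, and whose local Hessians are the multiples \<open>\<gamma> i\<close> of \<open>H\<close>.
\<close>

definition proportional_problem ::
  "nat \<Rightarrow> nat \<Rightarrow> real mat \<Rightarrow> (nat \<Rightarrow> nat) \<Rightarrow> (nat \<Rightarrow> real mat) \<Rightarrow> (nat \<Rightarrow> real vec) \<Rightarrow>
   real vec \<Rightarrow> (nat \<Rightarrow> real) \<Rightarrow> bool" where
  "proportional_problem b p H s X y \<beta>star \<gamma> \<longleftrightarrow>
     (\<forall>i<b. X i \<in> carrier_mat (s i) p \<and> y i \<in> carrier_vec (s i)) \<and>
     is_arg_min (global_loss b X y) (\<lambda>\<beta>. \<beta> \<in> carrier_vec p) \<beta>star \<and>
     hessian p (global_loss b X y) \<beta>star = H \<and>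
     (\<forall>i<b. hessian p (local_loss X y i) \<beta>star = \<gamma> i \<cdot>\<^sub>m H) \<and>
     (\<Sum>i<b. \<gamma> i) = 1"

definition local_variation ::
  "(real mat \<Rightarrow> real) \<Rightarrow> nat \<Rightarrow> nat \<Rightarrow> (nat \<Rightarrow> real mat) \<Rightarrow> (nat \<Rightarrow> real vec) \<Rightarrow> real vec \<Rightarrow> real" where
  "local_variation N b p X y \<beta>star =
     (\<Sum>i<b. N (hessian p (local_loss X y i) \<beta>star
                 - (1 / real b) \<cdot>\<^sub>m hessian p (global_loss b X y) \<beta>star))"

text \<open>FedAvg with local losses \<open>f 0, \<dots>, f (b - 1)\<close>\<close>

definition local_update :: "nat \<Rightarrow> nat \<Rightarrow> real \<Rightarrow> (real vec \<Rightarrow> real) \<Rightarrow> real vec \<Rightarrow> real vec" where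
  "local_update p h \<rho> f \<beta> = ((\<lambda>\<beta>. \<beta> - \<rho> \<cdot>\<^sub>v gradient p f \<beta>) ^^ h) \<beta>"

definition server_average :: "nat \<Rightarrow> nat \<Rightarrow> (nat \<Rightarrow> real vec) \<Rightarrow> real vec" where
  "server_average b p w = vec p (\<lambda>j. (1 / real b) * (\<Sum>i<b. w i $ j))"

definition fedavg_step ::
  "nat \<Rightarrow> nat \<Rightarrow> nat \<Rightarrow> real \<Rightarrow> (nat \<Rightarrow> real vec \<Rightarrow> real) \<Rightarrow> real vec \<Rightarrow> real vec" where
  "fedavg_step b p h \<rho> f \<beta> = server_average b p (\<lambda>i. local_update p h \<rho> (f i) \<beta>)"

text \<open>
  The same round on stacked vectors in \<open>\<real>\<^sup>b\<^sup>p\<close>: agent \<open>i\<close> starts from the \<open>i\<close>-th block and the average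
  is broadcast. Stacked vectors with equal blocks alone would not determine the linear part of
  the map.
\<close>

definition block :: "nat \<Rightarrow> real vec \<Rightarrow> nat \<Rightarrow> real vec" where
  "block p z i = vec p (\<lambda>j. z $ (i * p + j))"

definition fedavg_stacked ::
  "nat \<Rightarrow> nat \<Rightarrow> nat \<Rightarrow> real \<Rightarrow> (nat \<Rightarrow> real vec \<Rightarrow> real) \<Rightarrow> real vec \<Rightarrow> real vec" where
  "fedavg_stacked b p h \<rho> f z =
     kron_vec (ones_vec b) (server_average b p (\<lambda>i. local_update p h \<rho> (f i) (block p z i)))"

definition consensus_proj :: "nat \<Rightarrow> nat \<Rightarrow> real mat" where
  "consensus_proj b p =
     kron_mat ((1 / real b) \<cdot>\<^sub>m (mat_of_cols b [ones_vec b] * transpose_mat (mat_of_cols b [ones_vec b])))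
       (1\<^sub>m p)"

definition M_F :: "nat \<Rightarrow> nat \<Rightarrow> nat \<Rightarrow> real \<Rightarrow> real mat \<Rightarrow> (nat \<Rightarrow> real) \<Rightarrow> real mat" where
  "M_F b p h \<rho> H \<gamma> =
     consensus_proj b p * (1\<^sub>m (b * p) - \<rho> \<cdot>\<^sub>m kron_mat (mat_diag b \<gamma>) H) ^\<^sub>m h"

end

theory Submission
  imports Defs
begin

text \<open>
  Least-squares gradients are affine, so \<open>h\<close> local steps of agent \<open>i\<close> act linearly as
  \<open>(I - \<rho> \<gamma>\<^sub>i H)\<^sup>h\<close>, and a vector in the range of the averaging projection has equal blocks. Hence
  the nonzero eigenvalues of \<open>M_F\<close> are those of the \<open>p \<times> p\<close> matrix
  \<open>1/b \<Sum>\<^sub>i (I - \<rho> \<gamma>\<^sub>i H)\<^sup>h\<close>, a polynomial in \<open>H\<close>; by Schur triangularisation they are the numbers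
  \<open>q(x) = 1/b \<Sum>\<^sub>i (1 - \<rho> \<gamma>\<^sub>i x)\<^sup>h\<close> with \<open>x\<close> an eigenvalue of \<open>H\<close>. As \<open>\<gamma>\<^sub>i H\<close> is a Gram matrix,
  \<open>\<gamma>\<^sub>i \<ge> 0\<close>, which gives \<open>0 \<le> q(x) < 1\<close>. Jensen's inequality for \<open>t\<^sup>h\<close> gives
  \<open>q(x) \<ge> (1 - \<rho> x / b)\<^sup>h\<close>, the value of \<open>q(x)\<close> at \<open>\<gamma>\<^sub>i = 1/b\<close>, and \<open>\<sigma> = 0\<close> forces these weights. A
  problem with \<open>\<sigma> = 0\<close> is obtained by giving all agents a rescaled copy of one nonzero \<open>X\<^sub>i\<close>.
\<close>

subsection \<open>Spectral radius and affine iterations\<close>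

lemma smult_pow_mat:
  fixes A :: "'a::comm_ring_1 mat"
  assumes A: "A \<in> carrier_mat n n"
  shows "(c \<cdot>\<^sub>m A) ^\<^sub>m k = c ^ k \<cdot>\<^sub>m A ^\<^sub>m k"
proof (induction k)
  case 0
  then show ?case using A by (auto intro!: eq_matI)
next
  case (Suc k)
  have "A ^\<^sub>m k \<in> carrier_mat n n" using A by simp
  then show ?case using Suc A
    by (auto simp: mult_smult_distrib[where nr=n and n=n and nc=n] mult_smult_assoc_mat[where nr=n and n=n and nc=n]
        mult.commute intro!: eq_matI)
qed

lemma mult_pow_mat_commute:
  fixes A :: "'a::semiring_1 mat"
  assumes A: "A \<in> carrier_mat n n"
  shows "A * A ^\<^sub>m k = A ^\<^sub>m Suc k"
proof (induction k)
  case (Suc k)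
  have "A * A ^\<^sub>m Suc k = (A * A ^\<^sub>m k) * A"
    using assoc_mult_mat[OF A pow_carrier_mat[OF A] A] by simp
  then show ?case using Suc by simp
qed (use A in simp)

lemma eigenvalue_smult:
  fixes A :: "'a::field mat"
  assumes A: "A \<in> carrier_mat n n" and "eigenvalue (c \<cdot>\<^sub>m A) \<mu>" and c: "c \<noteq> 0"
  shows "eigenvalue A (\<mu> / c)"
proof -
  obtain v where v: "v \<in> carrier_vec n" "v \<noteq> 0\<^sub>v n" and e: "(c \<cdot>\<^sub>m A) *\<^sub>v v = \<mu> \<cdot>\<^sub>v v"
    using assms unfolding eigenvalue_def eigenvector_def by auto
  have "c * (A *\<^sub>v v) $ i = \<mu> * v $ i" if "i < n" for i
    using arg_cong[OF e, of "\<lambda>u. u $ i"] A v that by (simp add: smult_scalar_prod_distrib[where n=n])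
  then have "A *\<^sub>v v = (\<mu> / c) \<cdot>\<^sub>v v"
    using A v c by (intro eq_vecI) (auto simp: field_simps)
  then show ?thesis
    using A v unfolding eigenvalue_def eigenvector_def by auto
qed

lemma spectral_radius_witness:
  assumes "A \<in> carrier_mat n n" "n > 0"
  obtains \<mu> where "eigenvalue A \<mu>" "spectral_radius A = cmod \<mu>"
  using spectral_radius_mem_max(1)[OF assms] unfolding spectrum_def by auto

lemma cmod_le_spectral_radius:
  assumes "A \<in> carrier_mat n n" "n > 0" "eigenvalue A \<mu>"
  shows "cmod \<mu> \<le> spectral_radius A"
  using spectral_radius_mem_max(2)[OF assms(1,2)] assms(3) unfolding spectrum_def by auto

text \<open>For \<open>r\<close> strictly between the spectral radius and 1, the rescaled matrix
  \<open>A / r\<close> still has spectral radius below 1. The Jordan normal form bounds the entries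
  of its powers by a constant \<open>c\<close>, so those of \<open>A ^\<^sub>m k\<close> are at most
  \<open>c * r ^ k\<close>.\<close>

lemma pow_mat_tendsto_0:
  assumes A: "A \<in> carrier_mat n n" and n: "n > 0" and sr: "spectral_radius A < 1"
    and ij: "i < n" "j < n"
  shows "(\<lambda>k. (A ^\<^sub>m k) $$ (i, j)) \<longlonglongrightarrow> 0"
proof -
  define r where "r = (1 + spectral_radius A) / 2"
  have sr0: "0 \<le> spectral_radius A" using spectral_radius_witness[OF A n] by (metis norm_ge_zero)
  have r: "0 < r" "r < 1" "spectral_radius A < r" using sr sr0 by (auto simp: r_def)
  define B where "B = complex_of_real (1 / r) \<cdot>\<^sub>m A"
  have B: "B \<in> carrier_mat n n" using A by (simp add: B_def)
  obtain \<mu> where \<mu>: "eigenvalue B \<mu>" "spectral_radius B = cmod \<mu>"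
    using spectral_radius_witness[OF B n] .
  \<comment> \<open>Undoing the scaling turns an extremal eigenvalue of \<open>B\<close> into one of
    \<open>A\<close>, whose modulus lies below \<open>r\<close>.\<close>
  have "eigenvalue A (\<mu> / complex_of_real (1 / r))"
    using eigenvalue_smult[OF A \<mu>(1)[unfolded B_def]] r by simp
  then have "cmod (\<mu> / complex_of_real (1 / r)) < r"
    using cmod_le_spectral_radius[OF A n] r by fastforce
  then have "cmod \<mu> * r < 1 * r" using r by (simp add: norm_divide norm_mult)
  then have "spectral_radius B < 1" unfolding \<mu>(2) using r by (simp only: mult_less_cancel_right)
  then obtain c where c: "\<And>k. norm_bound (B ^\<^sub>m k) c"
    using spectral_radius_jnf_norm_bound_less_1_upper_triangular[OF B] by blast
  have "cmod ((A ^\<^sub>m k) $$ (i, j)) \<le> c * r ^ k" for k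
  proof -
    have "cmod ((B ^\<^sub>m k) $$ (i, j)) \<le> c"
      using c[of k] B ij unfolding norm_bound_def by simp
    then show ?thesis using A ij r
      by (simp add: B_def smult_pow_mat[OF A] norm_mult norm_divide norm_power field_simps)
  qed
  moreover have "(\<lambda>k. c * r ^ k) \<longlonglongrightarrow> 0"
    using r tendsto_mult_right_zero[OF LIMSEQ_power_zero[of r]] by simp
  ultimately show ?thesis by (rule Lim_null_comparison[OF always_eventually[OF allI]])
qed

text \<open>Since 1 is not an eigenvalue, \<open>A - 1\<close> is invertible and \<open>f\<close>
  has a fixed point \<open>l\<close>. The error obeys \<open>f^t x - l = A^t (x - l)\<close>, which
  tends to 0. The limit is fixed before the starting point, so all starting points share it.\<close>

lemma affine_iteration_converges:
  fixes A :: "real mat"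
  assumes A: "A \<in> carrier_mat n n" and n: "n > 0" and sr: "real_spectral_radius A < 1"
    and c: "c \<in> carrier_vec n" and f: "\<And>x. x \<in> carrier_vec n \<Longrightarrow> f x = A *\<^sub>v x + c"
  shows "\<exists>l \<in> carrier_vec n. \<forall>x \<in> carrier_vec n. \<forall>j<n. (\<lambda>t. (f ^^ t) x $ j) \<longlonglongrightarrow> l $ j"
proof -
  let ?A = "map_mat complex_of_real A"
  have cA: "?A \<in> carrier_mat n n" using A by simp
  have "\<not> eigenvalue A 1"
  proof
    assume "eigenvalue A 1"
    then have "eigenvalue ?A (complex_of_real 1)"
      by (rule of_real_hom.eigenvalue_hom[OF A])
    then show False using cmod_le_spectral_radius[OF cA n] sr
      unfolding real_spectral_radius_def by force
  qed
  then have "det (char_matrix A 1) \<noteq> 0" using eigenvalue_det[OF A] by simp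
  moreover have C: "char_matrix A 1 \<in> carrier_mat n n" using A by (simp add: char_matrix_def)
  ultimately obtain B where B: "B \<in> carrier_mat n n" "char_matrix A 1 * B = 1\<^sub>m n"
    using det_non_zero_imp_unit[OF C] unfolding Units_def ring_mat_def by auto
  \<comment> \<open>\<open>char_matrix A 1\<close> is \<open>A - 1\<close> and \<open>B\<close> is
    its right inverse, so \<open>l\<close> solves \<open>(A - 1) l = - c\<close>, the fixed point
    equation.\<close>
  define l where "l = B *\<^sub>v (- c)"
  have l: "l \<in> carrier_vec n" using B c by (simp add: l_def)
  have "char_matrix A 1 *\<^sub>v l = - c"
    using B C c by (simp add: l_def assoc_mult_mat_vec[symmetric, OF C B(1)])
  moreover have "char_matrix A 1 *\<^sub>v l = A *\<^sub>v l - l"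
    using A l by (intro eq_vecI) (auto simp: char_matrix_def add_mult_distrib_mat_vec[where nr=n and nc=n] smult_scalar_prod_distrib[where n=n])
  ultimately have e: "A *\<^sub>v l - l = - c" by simp
  have fix_pt: "A *\<^sub>v l + c = l"
  proof (rule eq_vecI)
    fix i assume "i < dim_vec l"
    then show "(A *\<^sub>v l + c) $ i = l $ i"
      using arg_cong[OF e, of "\<lambda>u. u $ i"] A l c by simp
  qed (use A l c in auto)
  have it: "(f ^^ t) x \<in> carrier_vec n \<and> (f ^^ t) x = A ^\<^sub>m t *\<^sub>v (x - l) + l" if x: "x \<in> carrier_vec n" for x t
  proof (induction t)
    case 0
    then show ?case using x l A by auto
  next
    case (Suc t)
    let ?w = "A ^\<^sub>m t *\<^sub>v (x - l)"
    have w: "?w \<in> carrier_vec n" using A x l by (metis minus_carrier_vec mult_mat_vec_carrier pow_carrier_mat)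
    have "(f ^^ Suc t) x = A *\<^sub>v (?w + l) + c" using Suc f[OF add_carrier_vec[OF w l]] by simp
    also have "\<dots> = A *\<^sub>v ?w + (A *\<^sub>v l + c)"
      using A l w c by (simp add: mult_add_distrib_mat_vec[OF A w l] assoc_add_vec[where n=n])
    also have "A *\<^sub>v ?w = A ^\<^sub>m Suc t *\<^sub>v (x - l)"
      using assoc_mult_mat_vec[OF A pow_carrier_mat[OF A] minus_carrier_vec[OF x l], symmetric]
        mult_pow_mat_commute[OF A, of t] by simp
    finally show ?case unfolding fix_pt using A x l w
      by (metis add_carrier_vec minus_carrier_vec mult_mat_vec_carrier pow_carrier_mat)
  qed
  show ?thesis
  proof (intro bexI[OF _ l] ballI allI impI)
    fix x :: "real vec" and j assume x: "x \<in> carrier_vec n" and j: "j < n"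
    \<comment> \<open>The decay is known for the complexified matrix, whose powers have the real
      entries of \<open>A ^\<^sub>m t\<close>.\<close>
    have p0: "(\<lambda>t. (A ^\<^sub>m t) $$ (j, k)) \<longlonglongrightarrow> 0" if k: "k < n" for k
    proof -
      have "(?A ^\<^sub>m t) $$ (j, k) = complex_of_real ((A ^\<^sub>m t) $$ (j, k))" for t
        using A j k pow_carrier_mat[OF A, of t] by (subst of_real_hom.mat_hom_pow[OF A, symmetric]) auto
      then show ?thesis
        using pow_mat_tendsto_0[OF cA n sr[unfolded real_spectral_radius_def] j k]
        by (simp add: tendsto_of_real_iff[of _ 0, where 'a=complex, simplified])
    qed
    have "(f ^^ t) x $ j = (\<Sum>k<n. (A ^\<^sub>m t) $$ (j, k) * (x - l) $ k) + l $ j" for t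
      using it[OF x, of t] A j x l pow_carrier_mat[OF A, of t]
      by (auto simp: scalar_prod_def lessThan_atLeast0 intro!: sum.cong)
    moreover have "(\<lambda>t. (\<Sum>k<n. (A ^\<^sub>m t) $$ (j, k) * (x - l) $ k) + l $ j) \<longlonglongrightarrow> (\<Sum>k<n. 0 * (x - l) $ k) + l $ j"
      by (intro tendsto_intros p0) auto
    ultimately show "(\<lambda>t. (f ^^ t) x $ j) \<longlonglongrightarrow> l $ j" by simp
  qed
qed

subsection \<open>Averages of powers of a matrix\<close>

text \<open>With \<open>w = 1/b\<close>, \<open>a i = \<rho> * \<gamma> i\<close> and
  \<open>k = b\<close> this is the linear part of one FedAvg round on a single parameter vector. The
  recursion starts from a zero matrix of the right dimension, and an arbitrary field allows passing
  to the complex numbers.\<close>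

primrec power_average :: "'a::field \<Rightarrow> (nat \<Rightarrow> 'a) \<Rightarrow> nat \<Rightarrow> 'a mat \<Rightarrow> nat \<Rightarrow> 'a mat" where
  "power_average w a h A 0 = 0\<^sub>m (dim_row A) (dim_row A)"
| "power_average w a h A (Suc k) =
     power_average w a h A k + w \<cdot>\<^sub>m (1\<^sub>m (dim_row A) - a k \<cdot>\<^sub>m A) ^\<^sub>m h"

lemma power_average_carrier [simp]:
  assumes "A \<in> carrier_mat n n"
  shows "power_average w a h A k \<in> carrier_mat n n"
proof (induction k)
  case (Suc k)
  have "1\<^sub>m (dim_row A) - a k \<cdot>\<^sub>m A \<in> carrier_mat n n" using assms by auto
  from pow_carrier_mat[OF this] show ?case using Suc by simp
qed (use assms in auto)

lemma power_average_index:
  assumes A: "A \<in> carrier_mat n n" and "i < n" "j < n"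
  shows "power_average w a h A k $$ (i, j) = w * (\<Sum>l<k. ((1\<^sub>m n - a l \<cdot>\<^sub>m A) ^\<^sub>m h) $$ (i, j))"
proof (induction k)
  case (Suc k)
  have "1\<^sub>m n - a k \<cdot>\<^sub>m A \<in> carrier_mat n n" using A by auto
  from pow_carrier_mat[OF this, of h] show ?case
    using Suc assms power_average_carrier[OF A, of w a h k] by (simp add: algebra_simps)
qed (use assms in auto)

lemma power_average_mult_vec_index:
  assumes A: "A \<in> carrier_mat n n" and v: "v \<in> carrier_vec n" and i: "i < n"
  shows "(power_average w a h A k *\<^sub>v v) $ i = w * (\<Sum>l<k. ((1\<^sub>m n - a l \<cdot>\<^sub>m A) ^\<^sub>m h *\<^sub>v v) $ i)"
proof -
  have c: "(1\<^sub>m n - a l \<cdot>\<^sub>m A) ^\<^sub>m h \<in> carrier_mat n n" for l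
    by (rule pow_carrier_mat) (use A in auto)
  have mv: "(B *\<^sub>v v) $ i = (\<Sum>j<n. B $$ (i, j) * v $ j)" if "B \<in> carrier_mat n n" for B
    using that v i by (auto simp: scalar_prod_def lessThan_atLeast0 intro!: sum.cong)
  have "(power_average w a h A k *\<^sub>v v) $ i
      = (\<Sum>j<n. \<Sum>l<k. w * (((1\<^sub>m n - a l \<cdot>\<^sub>m A) ^\<^sub>m h) $$ (i, j) * v $ j))"
    using power_average_carrier[OF A, of w a h k] i
    by (subst mv) (auto simp: power_average_index[OF A i] sum_distrib_left sum_distrib_right mult.assoc intro!: sum.cong)
  also have "\<dots> = w * (\<Sum>l<k. ((1\<^sub>m n - a l \<cdot>\<^sub>m A) ^\<^sub>m h *\<^sub>v v) $ i)"
    by (subst sum.swap) (simp add: mv[OF c] sum_distrib_left)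
  finally show ?thesis .
qed

lemma similar_mat_wit_one_minus_smult:
  fixes A :: "'a::field mat"
  assumes A: "A \<in> carrier_mat n n" and s: "similar_mat_wit A B P Q"
  shows "similar_mat_wit (1\<^sub>m n - c \<cdot>\<^sub>m A) (1\<^sub>m n - c \<cdot>\<^sub>m B) P Q"
proof -
  note D = similar_mat_witD2[OF A s]
  have "P * (1\<^sub>m n - c \<cdot>\<^sub>m B) * Q = (P - c \<cdot>\<^sub>m (P * B)) * Q"
    using D by (simp add: mult_minus_distrib_mat[of P n n "1\<^sub>m n" n] mult_smult_distrib[of P n n B n])
  also have "\<dots> = 1\<^sub>m n - c \<cdot>\<^sub>m A"
    using D by (simp add: minus_mult_distrib_mat[of P n n "c \<cdot>\<^sub>m (P * B)" Q n] mult_smult_assoc_mat[of "P * B" n n Q n])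
  finally show ?thesis using D by (intro similar_mat_witI[of P Q n]) auto
qed

text \<open>Every summand is a polynomial in \<open>A\<close>, so one pair \<open>P\<close>,
  \<open>Q\<close> conjugates all of them at once, and conjugation is linear.\<close>

lemma similar_power_average:
  fixes A :: "'a::field mat"
  assumes A: "A \<in> carrier_mat n n" and s: "similar_mat_wit A B P Q"
  shows "power_average w a h A k = P * power_average w a h B k * Q"
proof (induction k)
  case 0
  then show ?case using similar_mat_witD2[OF A s] by simp
next
  case (Suc k)
  note D = similar_mat_witD2[OF A s]
  define T where "T = (1\<^sub>m n - a k \<cdot>\<^sub>m B) ^\<^sub>m h"
  define S where "S = power_average w a h B k"
  have T: "T \<in> carrier_mat n n" unfolding T_def by (rule pow_carrier_mat) (use D in auto)
  have S: "S \<in> carrier_mat n n" unfolding S_def using D by auto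
  have "(1\<^sub>m n - a k \<cdot>\<^sub>m A) ^\<^sub>m h = P * T * Q"
    unfolding T_def by (rule similar_mat_wit_pow_id[OF similar_mat_wit_one_minus_smult[OF A s]])
  then have "power_average w a h A (Suc k) = P * S * Q + w \<cdot>\<^sub>m (P * T * Q)"
    using Suc D by (simp add: S_def)
  also have "w \<cdot>\<^sub>m (P * T * Q) = P * (w \<cdot>\<^sub>m T) * Q"
    using D T by (simp add: mult_smult_distrib[of P n n T n] mult_smult_assoc_mat[of "P * T" n n Q n])
  also have "P * S * Q + \<dots> = (P * S + P * (w \<cdot>\<^sub>m T)) * Q"
    using D T S by (simp add: add_mult_distrib_mat[of "P * S" n n "P * (w \<cdot>\<^sub>m T)" Q n])
  also have "P * S + P * (w \<cdot>\<^sub>m T) = P * (S + w \<cdot>\<^sub>m T)"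
    using D T S by (simp add: mult_add_distrib_mat[of P n n S n "w \<cdot>\<^sub>m T"])
  finally show ?case using D by (simp add: S_def T_def)
qed

section \<open>Triangular matrices and the spectral mapping for averages of powers\<close>

text \<open>In the sum over \<open>k\<close>, terms with \<open>k < i\<close> vanish because
  \<open>A\<close> is triangular and terms with \<open>k > i \<ge> j\<close> because
  \<open>B\<close> is. Only \<open>k = i\<close> remains.\<close>

lemma upper_triangular_mult_index:
  fixes A B :: "'a::semiring_0 mat"
  assumes A: "A \<in> carrier_mat n n" and B: "B \<in> carrier_mat n n"
    and uA: "upper_triangular A" and uB: "upper_triangular B" and "i < n" "j \<le> i"
  shows "(A * B) $$ (i, j) = (if j = i then A $$ (i, i) * B $$ (i, i) else 0)"
proof -
  have "(A * B) $$ (i, j) = (\<Sum>k<n. A $$ (i, k) * B $$ (k, j))"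
    using assms by (auto simp: scalar_prod_def lessThan_atLeast0 intro!: sum.cong)
  also have "\<dots> = (\<Sum>k<n. if k = i then (if j = i then A $$ (i, i) * B $$ (i, i) else 0) else 0)"
  proof (rule sum.cong[OF refl])
    fix k assume k: "k \<in> {..<n}"
    consider "k < i" | "k = i" | "i < k" by linarith
    then show "A $$ (i, k) * B $$ (k, j) = (if k = i then (if j = i then A $$ (i, i) * B $$ (i, i) else 0) else 0)"
    proof cases
      case 1
      then have "A $$ (i, k) = 0" using uA A assms by auto
      then show ?thesis using 1 by simp
    next
      case 2
      then show ?thesis using uB B assms by (auto dest: upper_triangularD[where i=i and j=j])
    next
      case 3
      then have "B $$ (k, j) = 0" using uB B assms k by auto
      then show ?thesis using 3 by simp
    qed
  qed
  also have "\<dots> = (if j = i then A $$ (i, i) * B $$ (i, i) else 0)" using assms by simp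
  finally show ?thesis .
qed

lemma upper_triangular_pow_mat:
  fixes A :: "'a::semiring_1 mat"
  assumes A: "A \<in> carrier_mat n n" and u: "upper_triangular A"
  shows "upper_triangular (A ^\<^sub>m k) \<and> (\<forall>i<n. (A ^\<^sub>m k) $$ (i, i) = A $$ (i, i) ^ k)"
proof (induction k)
  case 0
  then show ?case using A by (auto intro!: upper_triangularI)
next
  case (Suc k)
  have P: "A ^\<^sub>m k \<in> carrier_mat n n" using A by simp
  show ?case
    using Suc upper_triangular_mult_index[OF P A _ u] P A
    by (auto simp: power_commutes intro!: upper_triangularI)
qed

lemma upper_triangular_power_average:
  assumes B: "B \<in> carrier_mat n n" and u: "upper_triangular B"
  shows "upper_triangular (power_average w a h B k)"
    and "i < n \<Longrightarrow> power_average w a h B k $$ (i, i) = w * (\<Sum>l<k. (1 - a l * B $$ (i, i)) ^ h)"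
proof -
  have c: "1\<^sub>m n - a l \<cdot>\<^sub>m B \<in> carrier_mat n n" for l using B by auto
  have "upper_triangular (1\<^sub>m n - a l \<cdot>\<^sub>m B)" for l
    using B upper_triangularD[OF u] by (intro upper_triangularI) auto
  note U = upper_triangular_pow_mat[OF c this]
  show "upper_triangular (power_average w a h B k)"
  proof (rule upper_triangularI)
    fix i j assume ij: "j < i" "i < dim_row (power_average w a h B k)"
    then have "i < n" "j < n" using power_average_carrier[OF B, of w a h k] by auto
    moreover have "((1\<^sub>m n - a l \<cdot>\<^sub>m B) ^\<^sub>m h) $$ (i, j) = 0" for l
      using upper_triangularD[OF conjunct1[OF U[of l h]] ij(1)] \<open>i < n\<close> B by simp
    ultimately show "power_average w a h B k $$ (i, j) = 0"
      by (simp add: power_average_index[OF B])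
  qed
  show "power_average w a h B k $$ (i, i) = w * (\<Sum>l<k. (1 - a l * B $$ (i, i)) ^ h)" if "i < n"
    using U that B by (simp add: power_average_index[OF B])
qed

lemma eigenvalue_upper_triangular:
  fixes B :: "'a::field mat"
  assumes "B \<in> carrier_mat n n" "upper_triangular B"
  shows "eigenvalue B \<mu> \<longleftrightarrow> (\<exists>i<n. \<mu> = B $$ (i, i))"
  unfolding eigenvalue_root_char_poly[OF assms(1)] char_poly_upper_triangular[OF assms] poly_prod_list
  using assms by (auto simp: prod_list_zero_iff diag_mat_def)

lemma similar_mat_wit_eigenvalue:
  fixes A :: "'a::field mat"
  assumes "A \<in> carrier_mat n n" "similar_mat_wit A B P Q"
  shows "eigenvalue A \<mu> \<longleftrightarrow> eigenvalue B \<mu>"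
proof -
  have "char_poly A = char_poly B"
    by (rule char_poly_similar) (use assms in \<open>auto simp: similar_mat_def\<close>)
  then show ?thesis
    using similar_mat_witD2[OF assms] by (simp add: eigenvalue_root_char_poly[of _ n])
qed

text \<open>This is the spectral mapping theorem for the polynomial
  \<open>w * (\<Sum>l<k. (1 - a l * X) ^ h)\<close>. Over the complex numbers the characteristic
  polynomial splits, so \<open>A\<close> is similar to a triangular \<open>B\<close>. The same
  similarity carries the average for \<open>A\<close> to that for \<open>B\<close>, which is
  triangular too, and both spectra are read off the diagonals.\<close>

lemma eigenvalue_power_average:
  fixes A :: "complex mat"
  assumes A: "A \<in> carrier_mat n n"
  shows "eigenvalue (power_average w a h A k) \<mu> \<longleftrightarrow>
    (\<exists>x. eigenvalue A x \<and> \<mu> = w * (\<Sum>l<k. (1 - a l * x) ^ h))"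
proof -
  obtain es where es: "char_poly A = (\<Prod>e\<leftarrow>es. [:- e, 1:])" using char_poly_factorized[OF A] by blast
  obtain B P Q where s: "similar_mat_wit A B P Q" and u: "upper_triangular B"
    using schur_decomposition_exists[OF A es] unfolding similar_mat_def by blast
  note D = similar_mat_witD2[OF A s]
  have B: "B \<in> carrier_mat n n" using D by auto
  have s': "similar_mat_wit (power_average w a h A k) (power_average w a h B k) P Q"
    using D A B by (intro similar_mat_witI[of P Q n] similar_power_average[OF A s]) auto
  show ?thesis
    unfolding similar_mat_wit_eigenvalue[OF power_average_carrier[OF A] s'] similar_mat_wit_eigenvalue[OF A s]
      eigenvalue_upper_triangular[OF power_average_carrier[OF B] upper_triangular_power_average(1)[OF B u]]
      eigenvalue_upper_triangular[OF B u]
    by (auto simp: upper_triangular_power_average(2)[OF B u])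
qed

lemma of_real_power_average:
  assumes A: "A \<in> carrier_mat n n"
  shows "map_mat complex_of_real (power_average w a h A k)
    = power_average (of_real w) (\<lambda>i. of_real (a i)) h (map_mat complex_of_real A) k"
proof -
  have c: "1\<^sub>m n - a l \<cdot>\<^sub>m A \<in> carrier_mat n n" for l using A by auto
  have "map_mat complex_of_real (1\<^sub>m n - a l \<cdot>\<^sub>m A) = 1\<^sub>m n - of_real (a l) \<cdot>\<^sub>m map_mat complex_of_real A" for l
    using A by (intro eq_matI) auto
  then have "map_mat complex_of_real ((1\<^sub>m n - a l \<cdot>\<^sub>m A) ^\<^sub>m h)
      = (1\<^sub>m n - of_real (a l) \<cdot>\<^sub>m map_mat complex_of_real A) ^\<^sub>m h" for l
    by (simp add: of_real_hom.mat_hom_pow[OF c])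
  note e = this
  have "((1\<^sub>m n - of_real (a l) \<cdot>\<^sub>m map_mat complex_of_real A) ^\<^sub>m h) $$ (i, j)
      = of_real (((1\<^sub>m n - a l \<cdot>\<^sub>m A) ^\<^sub>m h) $$ (i, j))" if "i < n" "j < n" for i j l
    using that A carrier_matD[OF pow_carrier_mat[OF c[of l], of h]] by (subst e[symmetric]) simp
  note e' = this
  have cA: "map_mat complex_of_real A \<in> carrier_mat n n" using A by simp
  show ?thesis
  proof (rule eq_matI)
    fix i j
    assume "i < dim_row (power_average (of_real w) (\<lambda>i. of_real (a i)) h (map_mat complex_of_real A) k)"
      and "j < dim_col (power_average (of_real w) (\<lambda>i. of_real (a i)) h (map_mat complex_of_real A) k)"
    then have "i < n" "j < n" using carrier_matD[OF power_average_carrier[OF cA]] by metis+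
    then show "map_mat complex_of_real (power_average w a h A k) $$ (i, j)
        = power_average (of_real w) (\<lambda>i. of_real (a i)) h (map_mat complex_of_real A) k $$ (i, j)"
      using carrier_matD[OF power_average_carrier[OF A, of w a h k]]
      by (simp add: power_average_index[OF A] power_average_index[OF cA] e')
  qed (use carrier_matD[OF power_average_carrier[OF A]] carrier_matD[OF power_average_carrier[OF cA]] in simp_all)
qed

section \<open>Real spectrum of real symmetric matrices\<close>

lemma real_scalar_prod_self:
  fixes v :: "real vec"
  assumes "v \<in> carrier_vec n"
  shows "0 \<le> v \<bullet> v" and "v \<bullet> v = 0 \<longleftrightarrow> v = 0\<^sub>v n"
proof -
  have e: "v \<bullet> v = (\<Sum>i<n. (v $ i)\<^sup>2)"
    using assms by (simp add: scalar_prod_def lessThan_atLeast0 power2_eq_square)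
  show "0 \<le> v \<bullet> v" unfolding e by (simp add: sum_nonneg)
  have "v = 0\<^sub>v n \<longleftrightarrow> (\<forall>i<n. v $ i = 0)" using assms by auto
  then show "v \<bullet> v = 0 \<longleftrightarrow> v = 0\<^sub>v n"
    unfolding e by (auto simp: sum_nonneg_eq_0_iff)
qed

text \<open>Write the eigenvector as \<open>r + i s\<close> with real \<open>r\<close>,
  \<open>s\<close> and compare real and imaginary parts. Inserting the resulting formulas for
  \<open>A r\<close> and \<open>A s\<close> into the symmetry relation
  \<open>(A r) \<bullet> s = r \<bullet> (A s)\<close> leaves
  \<open>Im \<mu> * (r \<bullet> r + s \<bullet> s) = 0\<close>.\<close>

lemma symmetric_complex_eigenvalue:
  assumes A: "A \<in> carrier_mat n n" and sym: "transpose_mat A = A"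
    and e: "eigenvalue (map_mat complex_of_real A) \<mu>"
  obtains x where "\<mu> = of_real x" "eigenvalue A x"
proof -
  obtain v where v: "v \<in> carrier_vec n" "v \<noteq> 0\<^sub>v n"
    and ev: "map_mat complex_of_real A *\<^sub>v v = \<mu> \<cdot>\<^sub>v v"
    using e A unfolding eigenvalue_def eigenvector_def by auto
  define r where "r = map_vec Re v"
  define s where "s = map_vec Im v"
  have rs: "r \<in> carrier_vec n" "s \<in> carrier_vec n" using v by (auto simp: r_def s_def)
  have comp: "(\<Sum>j<n. of_real (A $$ (i, j)) * v $ j) = \<mu> * v $ i" if "i < n" for i
  proof -
    have "(\<Sum>j<n. of_real (A $$ (i, j)) * v $ j) = (map_mat complex_of_real A *\<^sub>v v) $ i"
      using A v that by (auto simp: scalar_prod_def lessThan_atLeast0 intro!: sum.cong)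
    then show ?thesis using v that by (simp add: ev)
  qed
  have mv: "(A *\<^sub>v u) $ i = (\<Sum>j<n. A $$ (i, j) * u $ j)" if "i < n" "u \<in> carrier_vec n" for u i
    using A that by (auto simp: scalar_prod_def lessThan_atLeast0 intro!: sum.cong)
  have sum_r: "(\<Sum>j<n. A $$ (i, j) * r $ j) = (\<Sum>j<n. A $$ (i, j) * Re (v $ j))"
    and sum_s: "(\<Sum>j<n. A $$ (i, j) * s $ j) = (\<Sum>j<n. A $$ (i, j) * Im (v $ j))" for i
    using v by (auto simp: r_def s_def intro!: sum.cong)
  have Ar: "A *\<^sub>v r = Re \<mu> \<cdot>\<^sub>v r - Im \<mu> \<cdot>\<^sub>v s"
  proof (rule eq_vecI)
    fix i assume "i < dim_vec (Re \<mu> \<cdot>\<^sub>v r - Im \<mu> \<cdot>\<^sub>v s)"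
    then have i: "i < n" using rs by simp
    then show "(A *\<^sub>v r) $ i = (Re \<mu> \<cdot>\<^sub>v r - Im \<mu> \<cdot>\<^sub>v s) $ i"
      using arg_cong[OF comp[OF i], of Re] v unfolding mv[OF i rs(1)] sum_r by (simp add: r_def s_def)
  qed (use A rs in auto)
  have As: "A *\<^sub>v s = Re \<mu> \<cdot>\<^sub>v s + Im \<mu> \<cdot>\<^sub>v r"
  proof (rule eq_vecI)
    fix i assume "i < dim_vec (Re \<mu> \<cdot>\<^sub>v s + Im \<mu> \<cdot>\<^sub>v r)"
    then have i: "i < n" using rs by simp
    then show "(A *\<^sub>v s) $ i = (Re \<mu> \<cdot>\<^sub>v s + Im \<mu> \<cdot>\<^sub>v r) $ i"
      using arg_cong[OF comp[OF i], of Im] v unfolding mv[OF i rs(2)] sum_s by (simp add: r_def s_def)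
  qed (use A rs in auto)
  have "(A *\<^sub>v r) \<bullet> s = r \<bullet> (A *\<^sub>v s)"
    using transpose_vec_mult_scalar[OF A rs(2,1)] sym A rs by (metis comm_scalar_prod mult_mat_vec_carrier)
  then have "Im \<mu> * (r \<bullet> r + s \<bullet> s) = 0"
    using rs comm_scalar_prod[OF rs(2) rs(1)] unfolding Ar As
    by (simp add: minus_scalar_prod_distrib[of _ n] scalar_prod_add_distrib[of _ n] algebra_simps)
  moreover have rs0: "r \<noteq> 0\<^sub>v n \<or> s \<noteq> 0\<^sub>v n"
  proof (rule ccontr)
    assume "\<not> ?thesis"
    then have "r $ i = 0" "s $ i = 0" if "i < n" for i using that by auto
    then have "v = 0\<^sub>v n" using v by (intro eq_vecI) (auto simp: r_def s_def complex_eq_iff)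
    then show False using v by simp
  qed
  ultimately have im: "Im \<mu> = 0"
    using real_scalar_prod_self[OF rs(1)] real_scalar_prod_self[OF rs(2)] by (auto simp: add_nonneg_eq_0_iff)
  have "A *\<^sub>v r = Re \<mu> \<cdot>\<^sub>v r" "A *\<^sub>v s = Re \<mu> \<cdot>\<^sub>v s"
    unfolding Ar As using im rs by (auto intro!: eq_vecI)
  \<comment> \<open>Whichever of \<open>r\<close> and \<open>s\<close> is nonzero serves as a real
    eigenvector.\<close>
  then have "eigenvalue A (Re \<mu>)"
    using rs0 rs A unfolding eigenvalue_def eigenvector_def by auto
  moreover have "\<mu> = of_real (Re \<mu>)" using im by (simp add: complex_eq_iff)
  ultimately show ?thesis using that by blast
qed

subsection \<open>Block structure of the linear part\<close>

text \<open>The flat index \<open>i * p + j\<close> is coordinate \<open>j\<close> of agent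
  \<open>i\<close>; this splits sums over stacked coordinates into sums over agents and
  coordinates.\<close>

lemma sum_lessThan_mult:
  fixes f :: "nat \<Rightarrow> 'a::comm_monoid_add"
  shows "(\<Sum>k<b * p. f k) = (\<Sum>i<b. \<Sum>j<p. f (i * p + j))"
proof -
  have "(\<Sum>k=i * p..<i * p + p. f k) = (\<Sum>j<p. f (i * p + j))" for i
    by (rule sum.reindex_bij_witness[of _ "\<lambda>j. i * p + j" "\<lambda>k. k - i * p"]) auto
  then show ?thesis by (simp flip: sum.nat_group)
qed

lemma block_index_less: "i * p + j < b * p" if "i < b" "j < p" for i j b p :: nat
proof -
  have "Suc i * p \<le> b * p" using that by (intro mult_le_mono1) simp
  then show ?thesis using that by simp
qed

text \<open>The second factor of \<open>M_F\<close>, before taking the power, has this shape with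
  blocks \<open>1 - \<rho> \<gamma>\<^sub>i H\<close>. Quotient and remainder of the flat index
  follow the convention of \<open>kron_mat\<close>.\<close>

definition block_diag :: "nat \<Rightarrow> nat \<Rightarrow> (nat \<Rightarrow> 'a::zero mat) \<Rightarrow> 'a mat" where
  "block_diag b p G = mat (b * p) (b * p)
     (\<lambda>(k, l). if k div p = l div p then G (k div p) $$ (k mod p, l mod p) else 0)"

lemma block_diag_mult:
  fixes G G' :: "nat \<Rightarrow> 'a::semiring_0 mat"
  assumes G: "\<And>i. i < b \<Longrightarrow> G i \<in> carrier_mat p p" "\<And>i. i < b \<Longrightarrow> G' i \<in> carrier_mat p p"
  shows "block_diag b p G * block_diag b p G' = block_diag b p (\<lambda>i. G i * G' i)"
proof (rule eq_matI)
  fix k l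
  assume "k < dim_row (block_diag b p (\<lambda>i. G i * G' i))" "l < dim_col (block_diag b p (\<lambda>i. G i * G' i))"
  then have kl: "k < b * p" "l < b * p" by (auto simp: block_diag_def)
  then have p: "p > 0" by (cases p) auto
  have d: "k div p < b" "k mod p < p" "l mod p < p" using kl p by (auto simp: less_mult_imp_div_less)
  have "(block_diag b p G * block_diag b p G') $$ (k, l)
      = (\<Sum>m<b * p. block_diag b p G $$ (k, m) * block_diag b p G' $$ (m, l))"
    using kl by (auto simp: block_diag_def scalar_prod_def lessThan_atLeast0 intro!: sum.cong)
  also have "\<dots> = (\<Sum>i<b. \<Sum>j<p. block_diag b p G $$ (k, i * p + j) * block_diag b p G' $$ (i * p + j, l))"
    by (rule sum_lessThan_mult)
  \<comment> \<open>The left factor vanishes outside the block of \<open>k\<close>, the right one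
    outside the block of \<open>l\<close>.\<close>
  also have "\<dots> = (\<Sum>i<b. if i = k div p
      then \<Sum>j<p. G (k div p) $$ (k mod p, j) * (if i = l div p then G' i $$ (j, l mod p) else 0) else 0)"
    using kl by (intro sum.cong refl) (auto simp: block_diag_def block_index_less intro!: sum.cong sum.neutral)
  also have "\<dots> = (\<Sum>j<p. G (k div p) $$ (k mod p, j) * (if k div p = l div p then G' (k div p) $$ (j, l mod p) else 0))"
    using d by simp
  also have "\<dots> = block_diag b p (\<lambda>i. G i * G' i) $$ (k, l)"
    using kl d G[OF d(1)]
    by (auto simp: block_diag_def scalar_prod_def lessThan_atLeast0 intro!: sum.cong)
  finally show "(block_diag b p G * block_diag b p G') $$ (k, l) = block_diag b p (\<lambda>i. G i * G' i) $$ (k, l)" .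
qed (auto simp: block_diag_def)

lemma block_diag_pow:
  fixes G :: "nat \<Rightarrow> 'a::semiring_1 mat"
  assumes G: "\<And>i. i < b \<Longrightarrow> G i \<in> carrier_mat p p"
  shows "block_diag b p G ^\<^sub>m h = block_diag b p (\<lambda>i. G i ^\<^sub>m h)"
proof (induction h)
  case 0
  show ?case
  proof (rule eq_matI)
    fix k l
    assume "k < dim_row (block_diag b p (\<lambda>i. G i ^\<^sub>m 0))" "l < dim_col (block_diag b p (\<lambda>i. G i ^\<^sub>m 0))"
    then have kl: "k < b * p" "l < b * p" by (auto simp: block_diag_def)
    then have p: "p > 0" by (cases p) auto
    have d: "k div p < b" "k mod p < p" "l mod p < p" using kl p by (auto simp: less_mult_imp_div_less)
    have "k = l \<longleftrightarrow> k div p = l div p \<and> k mod p = l mod p" by (metis div_mult_mod_eq)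
    then show "(block_diag b p G ^\<^sub>m 0) $$ (k, l) = block_diag b p (\<lambda>i. G i ^\<^sub>m 0) $$ (k, l)"
      using kl d G[OF d(1)] by (auto simp: block_diag_def)
  qed (auto simp: block_diag_def)
next
  case (Suc h)
  then show ?case using G by (simp add: block_diag_mult)
qed

section \<open>Entries and eigenvectors of the linear part\<close>

text \<open>The factor \<open>1/b\<close> times ones has constant entries and
  \<open>1\<^sub>m p\<close> contributes the Kronecker delta of the remainders, so the block numbers
  of \<open>k\<close> and \<open>l\<close> drop out.\<close>

lemma consensus_proj_index:
  assumes "k < b * p" "l < b * p"
  shows "consensus_proj b p $$ (k, l) = (if k mod p = l mod p then 1 / real b else 0)"
proof -
  have p: "p > 0" using assms by (cases p) auto
  have d: "k div p < b" "l div p < b" "k mod p < p" "l mod p < p"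
    using assms p by (auto simp: less_mult_imp_div_less)
  then show ?thesis using assms
    by (simp add: consensus_proj_def kron_mat_def ones_vec_def scalar_prod_def mat_of_cols_def)
qed

lemma M_F_carrier: "M_F b p h \<rho> H \<gamma> \<in> carrier_mat (b * p) (b * p)" if "H \<in> carrier_mat p p"
proof -
  have "1\<^sub>m (b * p) - \<rho> \<cdot>\<^sub>m kron_mat (mat_diag b \<gamma>) H \<in> carrier_mat (b * p) (b * p)"
    using that by (auto simp: kron_mat_def mat_diag_def)
  from pow_carrier_mat[OF this] show ?thesis
    unfolding M_F_def by (intro mult_carrier_mat) (auto simp: consensus_proj_def kron_mat_def)
qed

text \<open>The block diagonal factor is raised to the power \<open>h\<close> blockwise, and the
  averaging projection then replaces every block row by the mean of all block rows. Hence the row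
  index enters only through \<open>k mod p\<close>, while the column block selects the
  agent.\<close>

lemma M_F_index:
  assumes H: "H \<in> carrier_mat p p" and kl: "k < b * p" "l < b * p"
  shows "M_F b p h \<rho> H \<gamma> $$ (k, l)
    = 1 / real b * ((1\<^sub>m p - (\<rho> * \<gamma> (l div p)) \<cdot>\<^sub>m H) ^\<^sub>m h) $$ (k mod p, l mod p)"
proof -
  have p: "p > 0" using kl by (cases p) auto
  have d: "l div p < b" "k mod p < p" "l mod p < p" using kl p by (auto simp: less_mult_imp_div_less)
  define G where "G = (\<lambda>i. 1\<^sub>m p - (\<rho> * \<gamma> i) \<cdot>\<^sub>m H)"
  have G: "G i \<in> carrier_mat p p" for i using H by (auto simp: G_def)
  have "1\<^sub>m (b * p) - \<rho> \<cdot>\<^sub>m kron_mat (mat_diag b \<gamma>) H = block_diag b p G" (is "?L = _")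
  proof (rule eq_matI)
    fix r s assume "r < dim_row (block_diag b p G)" "s < dim_col (block_diag b p G)"
    then have rs: "r < b * p" "s < b * p" by (auto simp: block_diag_def)
    have "r div p < b" "s div p < b" "r mod p < p" "s mod p < p"
      using rs p by (auto simp: less_mult_imp_div_less)
    moreover have "r = s \<longleftrightarrow> r div p = s div p \<and> r mod p = s mod p" by (metis div_mult_mod_eq)
    ultimately show "?L $$ (r, s) = block_diag b p G $$ (r, s)"
      using rs H by (auto simp: block_diag_def G_def kron_mat_def mat_diag_def)
  qed (use H in \<open>auto simp: block_diag_def kron_mat_def mat_diag_def\<close>)
  then have "M_F b p h \<rho> H \<gamma> = consensus_proj b p * block_diag b p (\<lambda>i. G i ^\<^sub>m h)"
    by (simp add: M_F_def block_diag_pow[OF G])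
  then have "M_F b p h \<rho> H \<gamma> $$ (k, l)
      = (\<Sum>m<b * p. consensus_proj b p $$ (k, m) * block_diag b p (\<lambda>i. G i ^\<^sub>m h) $$ (m, l))"
    using kl by (auto simp: block_diag_def consensus_proj_def kron_mat_def scalar_prod_def lessThan_atLeast0 intro!: sum.cong)
  also have "\<dots> = (\<Sum>i<b. \<Sum>j<p. consensus_proj b p $$ (k, i * p + j) * block_diag b p (\<lambda>i. G i ^\<^sub>m h) $$ (i * p + j, l))"
    by (rule sum_lessThan_mult)
  \<comment> \<open>The projection entry selects the coordinate \<open>j\<close>, the block diagonal
    entry selects the agent \<open>i\<close>.\<close>
  also have "\<dots> = (\<Sum>i<b. \<Sum>j<p. if j = k mod p
      then if i = l div p then 1 / real b * (G i ^\<^sub>m h) $$ (k mod p, l mod p) else 0 else 0)"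
    using kl by (intro sum.cong refl) (auto simp: consensus_proj_index block_diag_def block_index_less)
  also have "\<dots> = 1 / real b * (G (l div p) ^\<^sub>m h) $$ (k mod p, l mod p)"
    using d by simp
  finally show ?thesis by (simp add: G_def)
qed

text \<open>Stated over any field because it serves twice: over the reals for the stacked FedAvg
  map, and over the complex numbers for the eigenvalues.\<close>

lemma block_average_mult_vec_index:
  fixes M :: "'a::field mat"
  assumes M: "M \<in> carrier_mat (b * p) (b * p)" and G: "\<And>i. i < b \<Longrightarrow> G i \<in> carrier_mat p p"
    and ix: "\<And>k l. k < b * p \<Longrightarrow> l < b * p \<Longrightarrow> M $$ (k, l) = w * G (l div p) $$ (k mod p, l mod p)"
    and z: "z \<in> carrier_vec (b * p)" and k: "k < b * p"
  shows "(M *\<^sub>v z) $ k = w * (\<Sum>i<b. (G i *\<^sub>v vec p (\<lambda>j. z $ (i * p + j))) $ (k mod p))"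
proof -
  have p: "p > 0" using k by (cases p) auto
  have "(M *\<^sub>v z) $ k = (\<Sum>l<b * p. M $$ (k, l) * z $ l)"
    using M z k by (auto simp: scalar_prod_def lessThan_atLeast0 intro!: sum.cong)
  also have "\<dots> = (\<Sum>i<b. \<Sum>j<p. w * (G i $$ (k mod p, j) * z $ (i * p + j)))"
    unfolding sum_lessThan_mult using k by (intro sum.cong refl) (simp add: ix block_index_less)
  also have "\<dots> = w * (\<Sum>i<b. \<Sum>j<p. G i $$ (k mod p, j) * z $ (i * p + j))"
    by (simp add: sum_distrib_left)
  also have "(\<Sum>j<p. G i $$ (k mod p, j) * z $ (i * p + j)) = (G i *\<^sub>v vec p (\<lambda>j. z $ (i * p + j))) $ (k mod p)"
    if "i < b" for i
    using G[OF that] p by (auto simp: scalar_prod_def lessThan_atLeast0 intro!: sum.cong)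
  then have "(\<Sum>i<b. \<Sum>j<p. G i $$ (k mod p, j) * z $ (i * p + j))
      = (\<Sum>i<b. (G i *\<^sub>v vec p (\<lambda>j. z $ (i * p + j))) $ (k mod p))"
    by (intro sum.cong) auto
  finally show ?thesis .
qed

text \<open>Every vector in the range of \<open>M\<close> has equal blocks. An eigenvector for a
  nonzero eigenvalue lies in that range, and its common block is an eigenvector of the average
  \<open>A\<close>. Conversely, \<open>b\<close> copies of an eigenvector of \<open>A\<close> form
  one of \<open>M\<close>. Kernel vectors of \<open>M\<close> may have different blocks, hence the
  condition \<open>\<mu> \<noteq> 0\<close> in the first direction.\<close>

lemma eigenvalue_block_average:
  fixes M :: "'a::field mat"
  assumes M: "M \<in> carrier_mat (b * p) (b * p)" and G: "\<And>i. i < b \<Longrightarrow> G i \<in> carrier_mat p p"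
    and ix: "\<And>k l. k < b * p \<Longrightarrow> l < b * p \<Longrightarrow> M $$ (k, l) = w * G (l div p) $$ (k mod p, l mod p)"
    and A: "A \<in> carrier_mat p p"
    and avg: "\<And>u j. u \<in> carrier_vec p \<Longrightarrow> j < p \<Longrightarrow> (A *\<^sub>v u) $ j = w * (\<Sum>i<b. (G i *\<^sub>v u) $ j)"
    and b: "b > 0"
  shows "eigenvalue M \<mu> \<Longrightarrow> \<mu> \<noteq> 0 \<Longrightarrow> eigenvalue A \<mu>" and "eigenvalue A \<mu> \<Longrightarrow> eigenvalue M \<mu>"
proof -
  have Mz: "(M *\<^sub>v z) $ k = w * (\<Sum>i<b. (G i *\<^sub>v vec p (\<lambda>j. z $ (i * p + j))) $ (k mod p))"
    if "z \<in> carrier_vec (b * p)" "k < b * p" for z k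
    by (rule block_average_mult_vec_index) (use M G ix that in auto)
  {
    assume "eigenvalue M \<mu>" and \<mu>: "\<mu> \<noteq> 0"
    then obtain z where z: "z \<in> carrier_vec (b * p)" "z \<noteq> 0\<^sub>v (b * p)" and e: "M *\<^sub>v z = \<mu> \<cdot>\<^sub>v z"
      using M unfolding eigenvalue_def eigenvector_def by auto
    define u where "u = vec p (\<lambda>j. z $ j)"
    have pb: "p \<le> b * p" using b by simp
    have M': "(M *\<^sub>v z) $ k = \<mu> * z $ k" if "k < b * p" for k using e z that by simp
    have zu: "z $ k = u $ (k mod p)" if k: "k < b * p" for k
    proof -
      have p: "p > 0" using k by (cases p) auto
      then have k': "k mod p < b * p" using pb mod_less_divisor[OF p, of k] by linarith
      \<comment> \<open>Rows \<open>k\<close> and \<open>k mod p\<close> of \<open>M\<close> give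
        the same value, and the factor \<open>\<mu>\<close> can be cancelled. So every block of
        \<open>z\<close> equals the first one, \<open>u\<close>.\<close>
      have "\<mu> * z $ k = \<mu> * z $ (k mod p)"
        unfolding M'[OF k, symmetric] M'[OF k', symmetric] Mz[OF z(1) k] Mz[OF z(1) k'] by simp
      then show ?thesis using \<mu> p by (simp add: u_def)
    qed
    have bl: "vec p (\<lambda>j. z $ (i * p + j)) = u" if "i < b" for i
      using zu[OF block_index_less[OF that]] by (intro eq_vecI) (auto simp: u_def)
    have "A *\<^sub>v u = \<mu> \<cdot>\<^sub>v u"
    proof (rule eq_vecI)
      fix j assume "j < dim_vec (\<mu> \<cdot>\<^sub>v u)"
      then have j: "j < p" by (simp add: u_def)
      have "\<mu> * z $ j = w * (\<Sum>i<b. (G i *\<^sub>v u) $ j)"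
        using Mz[OF z(1), of j] M'[of j] j pb by (simp add: bl)
      then show "(A *\<^sub>v u) $ j = (\<mu> \<cdot>\<^sub>v u) $ j" using j by (simp add: avg u_def)
    qed (use A in \<open>simp add: u_def\<close>)
    moreover have "u \<noteq> 0\<^sub>v p"
    proof
      assume u0: "u = 0\<^sub>v p"
      have "z $ k = 0" if k: "k < b * p" for k
      proof -
        have "k mod p < p" using k by (cases p) auto
        then show ?thesis using zu[OF k] u0 by simp
      qed
      then have "z = 0\<^sub>v (b * p)" using z by (intro eq_vecI) auto
      then show False using z by simp
    qed
    moreover have "u \<in> carrier_vec p" by (simp add: u_def)
    ultimately show "eigenvalue A \<mu>"
      using A unfolding eigenvalue_def eigenvector_def by auto
  }
  assume "eigenvalue A \<mu>"
  then obtain u where u: "u \<in> carrier_vec p" "u \<noteq> 0\<^sub>v p" and e: "A *\<^sub>v u = \<mu> \<cdot>\<^sub>v u"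
    using A unfolding eigenvalue_def eigenvector_def by auto
  define z where "z = vec (b * p) (\<lambda>k. u $ (k mod p))"
  have z: "z \<in> carrier_vec (b * p)" by (simp add: z_def)
  have bl: "vec p (\<lambda>j. z $ (i * p + j)) = u" if "i < b" for i
    using block_index_less[OF that] u by (intro eq_vecI) (auto simp: z_def)
  have "M *\<^sub>v z = \<mu> \<cdot>\<^sub>v z"
  proof (rule eq_vecI)
    fix k assume "k < dim_vec (\<mu> \<cdot>\<^sub>v z)"
    then have k: "k < b * p" by (simp add: z_def)
    then have m: "k mod p < p" by (cases p) auto
    have "(M *\<^sub>v z) $ k = (A *\<^sub>v u) $ (k mod p)"
      using Mz[OF z k] avg[OF u(1) m] by (simp add: bl)
    then show "(M *\<^sub>v z) $ k = (\<mu> \<cdot>\<^sub>v z) $ k" using k m u by (simp add: e z_def)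
  qed (use M in \<open>simp add: z_def\<close>)
  moreover have "z \<noteq> 0\<^sub>v (b * p)"
  proof
    assume z0: "z = 0\<^sub>v (b * p)"
    have "u $ j = 0" if "j < p" for j
      using arg_cong[OF z0, of "\<lambda>v. v $ j"] that b block_index_less[OF b that] by (simp add: z_def)
    then have "u = 0\<^sub>v p" using u by (intro eq_vecI) auto
    then show False using u by simp
  qed
  ultimately show "eigenvalue M \<mu>"
    using M z unfolding eigenvalue_def eigenvector_def by auto
qed

subsection \<open>Derivatives of the least-squares losses\<close>

lemma smult_mat_mult_vec:
  fixes A :: "'a::comm_semiring_1 mat"
  assumes "A \<in> carrier_mat n m" "v \<in> carrier_vec m"
  shows "(c \<cdot>\<^sub>m A) *\<^sub>v v = c \<cdot>\<^sub>v (A *\<^sub>v v)"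
  using assms by (intro eq_vecI) (auto simp: smult_scalar_prod_distrib[of _ m])

lemma mult_mat_vec_add_smult_unit:
  fixes X :: "real mat"
  assumes X: "X \<in> carrier_mat s p" and x: "x \<in> carrier_vec p" and j: "j < p"
  shows "X *\<^sub>v (x + t \<cdot>\<^sub>v unit_vec p j) = X *\<^sub>v x + t \<cdot>\<^sub>v col X j"
proof (rule eq_vecI)
  fix i assume "i < dim_vec (X *\<^sub>v x + t \<cdot>\<^sub>v col X j)"
  then have i: "i < s" using X by simp
  have "row X i \<bullet> (x + t \<cdot>\<^sub>v unit_vec p j) = row X i \<bullet> x + t * X $$ (i, j)"
    using X x j i by (simp add: scalar_prod_add_distrib[of _ p])
  then show "(X *\<^sub>v (x + t \<cdot>\<^sub>v unit_vec p j)) $ i = (X *\<^sub>v x + t \<cdot>\<^sub>v col X j) $ i"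
    using X i j by simp
qed (use X in simp)

text \<open>Along the coordinate line the residual is \<open>r + t c\<close>, with \<open>r\<close>
  the residual at \<open>x\<close> and \<open>c\<close> the \<open>j\<close>-th column of the data.
  The loss is then a quadratic polynomial in \<open>t\<close> with linear coefficient
  \<open>c \<bullet> r\<close>.\<close>

lemma local_loss_partial_derivative:
  assumes X: "X i \<in> carrier_mat s p" and y: "y i \<in> carrier_vec s" and x: "x \<in> carrier_vec p" and j: "j < p"
  shows "((\<lambda>t. local_loss X y i (x + t \<cdot>\<^sub>v unit_vec p j)) has_real_derivative
    (transpose_mat (X i) *\<^sub>v (X i *\<^sub>v x - y i)) $ j) (at 0)"
proof -
  define r where "r = X i *\<^sub>v x - y i"
  define c where "c = col (X i) j"
  have r: "r \<in> carrier_vec s" and c: "c \<in> carrier_vec s" using X y x j by (auto simp: r_def c_def)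
  have "X i *\<^sub>v (x + t \<cdot>\<^sub>v unit_vec p j) - y i = r + t \<cdot>\<^sub>v c" for t
    unfolding mult_mat_vec_add_smult_unit[OF X x j] using X y x by (intro eq_vecI) (auto simp: r_def c_def)
  then have "local_loss X y i (x + t \<cdot>\<^sub>v unit_vec p j) = 1 / 2 * (r \<bullet> r) + t * (c \<bullet> r) + t\<^sup>2 * (1 / 2 * (c \<bullet> c))" for t
    using r c comm_scalar_prod[OF r c]
    by (simp add: local_loss_def scalar_prod_add_distrib[of _ s] add_scalar_prod_distrib[of _ s] algebra_simps power2_eq_square)
  moreover have "(transpose_mat (X i) *\<^sub>v r) $ j = c \<bullet> r" using X j by (simp add: c_def)
  moreover have "((\<lambda>t. 1 / 2 * (r \<bullet> r) + t * (c \<bullet> r) + t\<^sup>2 * (1 / 2 * (c \<bullet> c))) has_real_derivative c \<bullet> r) (at 0)"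
    by (auto intro!: derivative_eq_intros)
  ultimately show ?thesis by (simp add: r_def)
qed

lemma gradient_local_loss:
  assumes X: "X i \<in> carrier_mat s p" and y: "y i \<in> carrier_vec s" and x: "x \<in> carrier_vec p"
  shows "gradient p (local_loss X y i) x = transpose_mat (X i) *\<^sub>v (X i *\<^sub>v x - y i)"
  unfolding gradient_def using X
  by (intro eq_vecI) (auto simp: DERIV_imp_deriv[OF local_loss_partial_derivative[where X=X and y=y and i=i, OF X y x]] simp del: index_mult_mat_vec)

lemma gradient_global_loss:
  assumes X: "\<And>i. i < b \<Longrightarrow> X i \<in> carrier_mat (s i) p" and y: "\<And>i. i < b \<Longrightarrow> y i \<in> carrier_vec (s i)"
    and x: "x \<in> carrier_vec p" and j: "j < p"
  shows "gradient p (global_loss b X y) x $ j = (\<Sum>i<b. gradient p (local_loss X y i) x $ j)"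
proof -
  have "((\<lambda>t. global_loss b X y (x + t \<cdot>\<^sub>v unit_vec p j)) has_real_derivative
      (\<Sum>i<b. (transpose_mat (X i) *\<^sub>v (X i *\<^sub>v x - y i)) $ j)) (at 0)"
    unfolding global_loss_def
    by (intro DERIV_sum local_loss_partial_derivative[OF X y x j]) auto
  moreover have "gradient p (local_loss X y i) x = transpose_mat (X i) *\<^sub>v (X i *\<^sub>v x - y i)" if "i < b" for i
    by (rule gradient_local_loss[where X=X and y=y and i=i, OF X[OF that] y[OF that] x])
  ultimately show ?thesis
    using j by (simp add: gradient_def[of p "global_loss b X y"] DERIV_imp_deriv del: index_mult_mat_vec)
qed

text \<open>The gradient is affine, so the derivative defining the Hessian is that of a linear
  function of \<open>t\<close>. Symmetry of the Gram matrix permits the index order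
  \<open>(k, j)\<close>.\<close>

lemma gradient_local_loss_shift:
  assumes X: "X i \<in> carrier_mat s p" and y: "y i \<in> carrier_vec s" and x: "x \<in> carrier_vec p"
    and jk: "j < p" "k < p"
  shows "gradient p (local_loss X y i) (x + t \<cdot>\<^sub>v unit_vec p k) $ j
    = gradient p (local_loss X y i) x $ j + t * (transpose_mat (X i) * X i) $$ (k, j)"
proof -
  define r where "r = X i *\<^sub>v x - y i"
  have r: "r \<in> carrier_vec s" using X y x by (auto simp: r_def)
  have c: "col (X i) j \<in> carrier_vec s" "col (X i) k \<in> carrier_vec s" using X jk by auto
  have x': "x + t \<cdot>\<^sub>v unit_vec p k \<in> carrier_vec p" using x by auto
  have "X i *\<^sub>v (x + t \<cdot>\<^sub>v unit_vec p k) - y i = r + t \<cdot>\<^sub>v col (X i) k"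
    unfolding mult_mat_vec_add_smult_unit[OF X x jk(2)] using X y x by (intro eq_vecI) (auto simp: r_def)
  then show ?thesis
    unfolding gradient_local_loss[where X=X and y=y and i=i, OF X y x] gradient_local_loss[where X=X and y=y and i=i, OF X y x']
    using X jk r c comm_scalar_prod[OF c] by (simp add: scalar_prod_add_distrib[of _ s] flip: r_def)
qed

lemma hessian_local_loss:
  assumes X: "X i \<in> carrier_mat s p" and y: "y i \<in> carrier_vec s" and x: "x \<in> carrier_vec p"
  shows "hessian p (local_loss X y i) x = transpose_mat (X i) * X i"
proof (rule eq_matI)
  fix k j assume "k < dim_row (transpose_mat (X i) * X i)" "j < dim_col (transpose_mat (X i) * X i)"
  then have kj: "k < p" "j < p" using X by auto
  have "((\<lambda>t. gradient p (local_loss X y i) (x + t \<cdot>\<^sub>v unit_vec p k) $ j) has_real_derivative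
      (transpose_mat (X i) * X i) $$ (k, j)) (at 0)"
    unfolding gradient_local_loss_shift[where X=X and y=y and i=i, OF X y x kj(2,1)] by (auto intro!: derivative_eq_intros)
  then show "hessian p (local_loss X y i) x $$ (k, j) = (transpose_mat (X i) * X i) $$ (k, j)"
    using kj by (simp add: hessian_def DERIV_imp_deriv)
qed (use X in \<open>auto simp: hessian_def\<close>)

lemma hessian_global_loss_index:
  assumes X: "\<And>i. i < b \<Longrightarrow> X i \<in> carrier_mat (s i) p" and y: "\<And>i. i < b \<Longrightarrow> y i \<in> carrier_vec (s i)"
    and x: "x \<in> carrier_vec p" and kj: "k < p" "j < p"
  shows "hessian p (global_loss b X y) x $$ (k, j) = (\<Sum>i<b. (transpose_mat (X i) * X i) $$ (k, j))"
proof -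
  have x': "x + t \<cdot>\<^sub>v unit_vec p k \<in> carrier_vec p" for t using x by auto
  have "gradient p (global_loss b X y) (x + t \<cdot>\<^sub>v unit_vec p k) $ j
      = (\<Sum>i<b. gradient p (local_loss X y i) x $ j + t * (transpose_mat (X i) * X i) $$ (k, j))" for t
  proof -
    have "gradient p (local_loss X y i) (x + t \<cdot>\<^sub>v unit_vec p k) $ j
        = gradient p (local_loss X y i) x $ j + t * (transpose_mat (X i) * X i) $$ (k, j)" if "i < b" for i
      by (rule gradient_local_loss_shift[where X=X and y=y and i=i, OF X[OF that] y[OF that] x kj(2,1)])
    then show ?thesis
      using gradient_global_loss[of b X s p y "x + t \<cdot>\<^sub>v unit_vec p k" j] X y x' kj by simp
  qed
  moreover have "((\<lambda>t. \<Sum>i<b. gradient p (local_loss X y i) x $ j + t * (transpose_mat (X i) * X i) $$ (k, j))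
      has_real_derivative (\<Sum>i<b. (transpose_mat (X i) * X i) $$ (k, j))) (at 0)"
    by (intro DERIV_sum) (auto intro!: derivative_eq_intros)
  ultimately show ?thesis using kj by (simp add: hessian_def DERIV_imp_deriv)
qed

text \<open>One gradient step is the affine map \<open>x \<mapsto> G x + d\<close> with
  \<open>G = 1 - \<rho> g H\<close> and \<open>d\<close> equal to \<rho> times the transposed data
  applied to \<open>y i\<close>. Composing it \<open>h\<close> times gives linear part
  \<open>G^h\<close> and some constant independent of \<open>x\<close>.\<close>

lemma local_update_affine:
  assumes X: "X i \<in> carrier_mat s p" and y: "y i \<in> carrier_vec s" and H: "H \<in> carrier_mat p p"
    and XX: "transpose_mat (X i) * X i = g \<cdot>\<^sub>m H"
  shows "\<exists>c \<in> carrier_vec p. \<forall>x \<in> carrier_vec p.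
    local_update p h \<rho> (local_loss X y i) x = (1\<^sub>m p - (\<rho> * g) \<cdot>\<^sub>m H) ^\<^sub>m h *\<^sub>v x + c"
proof -
  define G where "G = 1\<^sub>m p - (\<rho> * g) \<cdot>\<^sub>m H"
  define d where "d = \<rho> \<cdot>\<^sub>v (transpose_mat (X i) *\<^sub>v y i)"
  have G: "G \<in> carrier_mat p p" and d: "d \<in> carrier_vec p" using H X y by (auto simp: G_def d_def)
  have step: "x - \<rho> \<cdot>\<^sub>v gradient p (local_loss X y i) x = G *\<^sub>v x + d" if x: "x \<in> carrier_vec p" for x
  proof -
    have "gradient p (local_loss X y i) x = (g \<cdot>\<^sub>m H) *\<^sub>v x - transpose_mat (X i) *\<^sub>v y i"
      unfolding gradient_local_loss[where X=X and y=y and i=i, OF X y x] XX[symmetric] using X x y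
      by (simp add: mult_minus_distrib_mat_vec[of _ p s] assoc_mult_mat_vec[of _ p s _ p])
    moreover have "G *\<^sub>v x = x - (\<rho> * g) \<cdot>\<^sub>v (H *\<^sub>v x)"
      using H x by (simp add: G_def minus_mult_distrib_mat_vec[of _ p p] smult_mat_mult_vec[of _ p p])
    ultimately show ?thesis using H X x y
      by (intro eq_vecI) (auto simp: d_def algebra_simps smult_mat_mult_vec[of _ p p] simp del: index_mult_mat_vec)
  qed
  have "\<exists>c \<in> carrier_vec p. \<forall>x \<in> carrier_vec p.
      ((\<lambda>\<beta>. \<beta> - \<rho> \<cdot>\<^sub>v gradient p (local_loss X y i) \<beta>) ^^ h) x = G ^\<^sub>m h *\<^sub>v x + c"
  proof (induction h)
    case 0
    show ?case using G by (intro bexI[of _ "0\<^sub>v p"]) auto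
  next
    case (Suc h)
    then obtain c where c: "c \<in> carrier_vec p" and
      IH: "\<And>x. x \<in> carrier_vec p \<Longrightarrow> ((\<lambda>\<beta>. \<beta> - \<rho> \<cdot>\<^sub>v gradient p (local_loss X y i) \<beta>) ^^ h) x = G ^\<^sub>m h *\<^sub>v x + c"
      by blast
    have Gh: "G ^\<^sub>m h \<in> carrier_mat p p" using G by simp
    show ?case
    proof (intro bexI ballI)
      fix x :: "real vec" assume x: "x \<in> carrier_vec p"
      have Gx: "G *\<^sub>v x \<in> carrier_vec p" using G x by simp
      \<comment> \<open>Splitting off the first step, not the last, produces \<open>G^h G\<close>,
        which is how matrix powers unfold.\<close>
      have "((\<lambda>\<beta>. \<beta> - \<rho> \<cdot>\<^sub>v gradient p (local_loss X y i) \<beta>) ^^ Suc h) x = G ^\<^sub>m h *\<^sub>v (G *\<^sub>v x + d) + c"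
        unfolding funpow_Suc_right comp_def step[OF x] using IH Gx d by simp
      then show "((\<lambda>\<beta>. \<beta> - \<rho> \<cdot>\<^sub>v gradient p (local_loss X y i) \<beta>) ^^ Suc h) x
          = G ^\<^sub>m Suc h *\<^sub>v x + (G ^\<^sub>m h *\<^sub>v d + c)"
        using Gh G Gx x c d
        by (simp add: mult_add_distrib_mat_vec[OF Gh Gx d] assoc_add_vec[of _ p] assoc_mult_mat_vec[OF Gh G x])
    qed (use Gh c d in simp)
  qed
  then show ?thesis unfolding local_update_def G_def .
qed

subsection \<open>Eigenvalues of the linear part\<close>

text \<open>The eigenvalue of \<open>M_F\<close> belonging to the eigenvalue \<open>x\<close> of the global Hessian.\<close>

definition mean_contraction :: "nat \<Rightarrow> nat \<Rightarrow> real \<Rightarrow> (nat \<Rightarrow> real) \<Rightarrow> real \<Rightarrow> real" where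
  "mean_contraction b h \<rho> \<gamma> x = 1 / real b * (\<Sum>l<b. (1 - \<rho> * \<gamma> l * x) ^ h)"

text \<open>The spectral mapping is combined with the fact that the complexified symmetric
  \<open>H\<close> has only real eigenvalues.\<close>

lemma of_real_eigenvalue_power_average:
  assumes H: "H \<in> carrier_mat p p" and sym: "transpose_mat H = H"
  shows "eigenvalue (map_mat complex_of_real (power_average (1 / real b) (\<lambda>i. \<rho> * \<gamma> i) h H b)) \<mu> \<longleftrightarrow>
    (\<exists>x. eigenvalue H x \<and> \<mu> = of_real (mean_contraction b h \<rho> \<gamma> x))"
proof -
  have cH: "map_mat complex_of_real H \<in> carrier_mat p p" using H by simp
  have "eigenvalue (map_mat complex_of_real H) z \<longleftrightarrow> (\<exists>x. eigenvalue H x \<and> z = of_real x)" for z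
    using symmetric_complex_eigenvalue[OF H sym] of_real_hom.eigenvalue_hom[OF H] by metis
  then show ?thesis
    unfolding of_real_power_average[OF H] eigenvalue_power_average[OF cH]
    by (auto simp: mean_contraction_def)
qed

text \<open>The block reduction passes from \<open>M_F\<close> to the average of the powers
  \<open>(1 - \<rho> \<gamma>\<^sub>i H)^h\<close>, whose spectrum is known. The eigenvalue 0 is
  exempt in the first part, since the averaging projection may add a kernel.\<close>

lemma eigenvalue_M_F:
  assumes H: "H \<in> carrier_mat p p" and sym: "transpose_mat H = H" and b: "b > 0"
  shows "eigenvalue (map_mat complex_of_real (M_F b p h \<rho> H \<gamma>)) \<mu> \<Longrightarrow> \<mu> \<noteq> 0 \<Longrightarrow>
      \<exists>x. eigenvalue H x \<and> \<mu> = of_real (mean_contraction b h \<rho> \<gamma> x)"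
    and "eigenvalue H x \<Longrightarrow>
      eigenvalue (map_mat complex_of_real (M_F b p h \<rho> H \<gamma>)) (of_real (mean_contraction b h \<rho> \<gamma> x))"
proof -
  let ?H = "map_mat complex_of_real H"
  let ?M = "map_mat complex_of_real (M_F b p h \<rho> H \<gamma>)"
  let ?A = "map_mat complex_of_real (power_average (1 / real b) (\<lambda>i. \<rho> * \<gamma> i) h H b)"
  let ?R = "\<lambda>i. (1\<^sub>m p - (\<rho> * \<gamma> i) \<cdot>\<^sub>m H) ^\<^sub>m h"
  let ?G = "\<lambda>i. map_mat complex_of_real (?R i)"
  have cH: "?H \<in> carrier_mat p p" using H by simp
  have R: "?R i \<in> carrier_mat p p" for i by (rule pow_carrier_mat) (use H in auto)
  have G: "?G i \<in> carrier_mat p p" for i using R[of i] by simp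
  have G': "?G i = (1\<^sub>m p - of_real (\<rho> * \<gamma> i) \<cdot>\<^sub>m ?H) ^\<^sub>m h" for i
  proof -
    have "map_mat complex_of_real (1\<^sub>m p - (\<rho> * \<gamma> i) \<cdot>\<^sub>m H) = 1\<^sub>m p - of_real (\<rho> * \<gamma> i) \<cdot>\<^sub>m ?H"
      using H by (intro eq_matI) auto
    moreover have "1\<^sub>m p - (\<rho> * \<gamma> i) \<cdot>\<^sub>m H \<in> carrier_mat p p" using H by auto
    ultimately show ?thesis by (simp only: of_real_hom.mat_hom_pow)
  qed
  have M: "?M \<in> carrier_mat (b * p) (b * p)" using M_F_carrier[OF H] by simp
  have A: "?A \<in> carrier_mat p p" using power_average_carrier[OF H] by simp
  have ix: "?M $$ (k, l) = of_real (1 / real b) * ?G (l div p) $$ (k mod p, l mod p)"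
    if "k < b * p" "l < b * p" for k l
  proof -
    have "p > 0" using that by (cases p) auto
    then show ?thesis
      using that carrier_matD[OF M_F_carrier[OF H, of b h \<rho> \<gamma>]] carrier_matD[OF R[of "l div p"]]
      by (simp add: M_F_index[OF H that])
  qed
  have avg: "(?A *\<^sub>v u) $ j = of_real (1 / real b) * (\<Sum>i<b. (?G i *\<^sub>v u) $ j)"
    if "u \<in> carrier_vec p" "j < p" for u j
    unfolding of_real_power_average[OF H] G' by (rule power_average_mult_vec_index[OF cH that])
  note E = eigenvalue_block_average[OF M G ix A avg b, unfolded of_real_eigenvalue_power_average[OF H sym]]
  show "eigenvalue ?M \<mu> \<Longrightarrow> \<mu> \<noteq> 0 \<Longrightarrow> \<exists>x. eigenvalue H x \<and> \<mu> = of_real (mean_contraction b h \<rho> \<gamma> x)"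
    using E(1) by blast
  show "eigenvalue H x \<Longrightarrow> eigenvalue ?M (of_real (mean_contraction b h \<rho> \<gamma> x))"
    using E(2) by blast
qed

text \<open>The numbers \<open>1 - \<rho> \<gamma>\<^sub>i x\<close> lie in \<open>[0, 1]\<close>
  and sum to \<open>b - \<rho> x\<close>. Powers with \<open>h \<ge> 1\<close> do not exceed their
  bases, so the mean stays below 1. Jensen's inequality bounds it below by the \<open>h\<close>-th
  power of the mean base, \<open>1 - \<rho> x / b\<close>. The last claim makes that power equal to
  its modulus.\<close>

lemma mean_contraction_bounds:
  fixes \<gamma> :: "nat \<Rightarrow> real"
  assumes b: "b > 0" and h: "h \<ge> 1" and \<rho>: "0 < \<rho>" and x: "0 < x" "\<rho> * x < 1"
    and \<gamma>: "\<And>i. i < b \<Longrightarrow> 0 \<le> \<gamma> i" "(\<Sum>i<b. \<gamma> i) = 1"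
  shows "mean_contraction b h \<rho> \<gamma> x < 1"
    and "0 \<le> mean_contraction b h \<rho> \<gamma> x"
    and "(1 - \<rho> * x / real b) ^ h \<le> mean_contraction b h \<rho> \<gamma> x"
    and "0 \<le> 1 - \<rho> * x / real b"
proof -
  have u: "0 \<le> 1 - \<rho> * \<gamma> i * x" "1 - \<rho> * \<gamma> i * x \<le> 1" if "i < b" for i
  proof -
    \<comment> \<open>Nonnegative weights with sum 1 are at most 1, so
      \<open>\<rho> \<gamma>\<^sub>i x \<le> \<rho> x < 1\<close>.\<close>
    have "\<gamma> i \<le> (\<Sum>i<b. \<gamma> i)" using that \<gamma> by (intro member_le_sum) auto
    then have "(\<rho> * x) * \<gamma> i \<le> (\<rho> * x) * 1" using \<rho> x \<gamma> by (intro mult_left_mono) auto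
    then show "0 \<le> 1 - \<rho> * \<gamma> i * x" using x by (simp add: ac_simps)
    show "1 - \<rho> * \<gamma> i * x \<le> 1" using \<rho> x \<gamma>(1)[OF that] by simp
  qed
  have "(\<Sum>i<b. \<rho> * \<gamma> i * x) = \<rho> * x * (\<Sum>i<b. \<gamma> i)"
    by (simp add: sum_distrib_left ac_simps)
  then have s: "(\<Sum>i<b. 1 - \<rho> * \<gamma> i * x) = real b - \<rho> * x"
    using \<gamma> by (simp add: sum_subtractf)
  have "(\<Sum>i<b. (1 - \<rho> * \<gamma> i * x) ^ h) \<le> (\<Sum>i<b. 1 - \<rho> * \<gamma> i * x)"
    using u h by (intro sum_mono) (metis lessThan_iff power_decreasing power_one_right)
  then have "(\<Sum>i<b. (1 - \<rho> * \<gamma> i * x) ^ h) < real b"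
    using mult_pos_pos[OF \<rho> x(1)] by (simp add: s)
  then show "mean_contraction b h \<rho> \<gamma> x < 1" using b by (simp add: mean_contraction_def)
  show "0 \<le> mean_contraction b h \<rho> \<gamma> x"
    unfolding mean_contraction_def using u by (intro mult_nonneg_nonneg sum_nonneg) auto
  \<comment> \<open>Odd powers are convex only on the nonnegative half line, which contains all
    bases.\<close>
  have cv: "convex_on {0::real..} (\<lambda>x. x ^ h)"
    by (cases "even h") (auto intro: convex_power_odd convex_on_subset[OF convex_power_even])
  have "(\<Sum>i<b. (1 / real b) *\<^sub>R (1 - \<rho> * \<gamma> i * x)) ^ h \<le> (\<Sum>i<b. 1 / real b * (1 - \<rho> * \<gamma> i * x) ^ h)"
    using convex_on_sum[OF _ _ cv, of "{..<b}" "\<lambda>_. 1 / real b" "\<lambda>i. 1 - \<rho> * \<gamma> i * x"] u b by auto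
  moreover have "(\<Sum>i<b. (1 / real b) *\<^sub>R (1 - \<rho> * \<gamma> i * x)) = 1 - \<rho> * x / real b"
    using b s by (simp flip: sum_distrib_left sum_divide_distrib) (simp add: field_simps)
  ultimately show "(1 - \<rho> * x / real b) ^ h \<le> mean_contraction b h \<rho> \<gamma> x"
    by (simp add: mean_contraction_def sum_distrib_left)
  have "\<rho> * x / real b \<le> \<rho> * x / 1" using b \<rho> x by (intro divide_left_mono) auto
  then show "0 \<le> 1 - \<rho> * x / real b" using x by simp
qed

lemma smult_smult_mat: "c \<cdot>\<^sub>m (d \<cdot>\<^sub>m A) = (c * d) \<cdot>\<^sub>m (A :: 'a::semigroup_mult mat)"
  by (intro eq_matI) (auto simp: mult.assoc)

text \<open>An eigenvector \<open>v\<close> gives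
  \<open>x * (v \<bullet> v) = v \<bullet> (H v) > 0\<close>. The spectrum is finite, so
  \<open>x\<close> is at most its maximum, which is therefore positive and may be multiplied across
  the bound on \<rho>.\<close>

lemma pos_def_eigenvalue_bounds:
  assumes pd: "pos_def_mat p H" and \<rho>: "0 < \<rho>" "\<rho> < 1 / lambda_max H" and e: "eigenvalue H x"
  shows "0 < x" and "\<rho> * x < 1"
proof -
  have H: "H \<in> carrier_mat p p" using pd by (simp add: pos_def_mat_def)
  obtain v where v: "v \<in> carrier_vec p" "v \<noteq> 0\<^sub>v p" "H *\<^sub>v v = x \<cdot>\<^sub>v v"
    using e H unfolding eigenvalue_def eigenvector_def by auto
  have "0 < v \<bullet> (H *\<^sub>v v)" using pd v(1,2) unfolding pos_def_mat_def by blast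
  then have "0 < x * (v \<bullet> v)" using v by simp
  then show x: "0 < x" using real_scalar_prod_self(1)[OF v(1)] by (simp add: zero_less_mult_iff)
  have "x \<le> lambda_max H" unfolding lambda_max_def
    by (rule Max_ge) (use card_finite_spectrum[OF H] e in \<open>auto simp: spectrum_def\<close>)
  then have l: "\<rho> * x \<le> \<rho> * lambda_max H" "0 < lambda_max H" using \<rho> x by auto
  then have "\<rho> * lambda_max H < 1" using \<rho> by (simp add: pos_less_divide_eq)
  then show "\<rho> * x < 1" using l by linarith
qed

subsection \<open>Proportional least-squares problems\<close>

context
  fixes b p :: nat and H :: "real mat" and s :: "nat \<Rightarrow> nat" and X :: "nat \<Rightarrow> real mat"
    and y :: "nat \<Rightarrow> real vec" and \<beta>star :: "real vec" and \<gamma> :: "nat \<Rightarrow> real"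
  assumes prob: "proportional_problem b p H s X y \<beta>star \<gamma>"
begin

text \<open>There is at least one agent because an empty family of weights would sum to 0 instead of
  1.\<close>

lemma proportional_problem_data:
  "i < b \<Longrightarrow> X i \<in> carrier_mat (s i) p" "i < b \<Longrightarrow> y i \<in> carrier_vec (s i)"
  "\<beta>star \<in> carrier_vec p" "(\<Sum>i<b. \<gamma> i) = 1" "b > 0"
  using prob by (auto simp: proportional_problem_def is_arg_min_def intro: gr0I)

text \<open>The Hessian of a least-squares loss is the same Gram matrix at every point, so the
  condition at the minimizer is a condition on the data.\<close>

lemma proportional_problem_gram:
  assumes "i < b"
  shows "transpose_mat (X i) * X i = \<gamma> i \<cdot>\<^sub>m H"
  using hessian_local_loss[where X=X and y=y and i=i, OF proportional_problem_data(1)[OF assms] proportional_problem_data(2)[OF assms] proportional_problem_data(3)]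
    prob assms unfolding proportional_problem_def by metis

text \<open>Testing the Gram identity on a nonzero vector \<open>e\<close> gives \<open>\<gamma> i *
  (e \<bullet> (H e)) = (X i e) \<bullet> (X i e) \<ge> 0\<close>, and
  \<open>e \<bullet> (H e)\<close> is positive.\<close>

lemma proportional_problem_weight_nonneg:
  assumes pd: "pos_def_mat p H" and p: "p \<ge> 1" and i: "i < b"
  shows "0 \<le> \<gamma> i"
proof -
  have H: "H \<in> carrier_mat p p" using pd by (simp add: pos_def_mat_def)
  define e :: "real vec" where "e = unit_vec p 0"
  have e: "e \<in> carrier_vec p" "e \<noteq> 0\<^sub>v p" using p by (auto simp: e_def)
  have He: "H *\<^sub>v e \<in> carrier_vec p" using H e by simp
  note X = proportional_problem_data(1)[OF i]
  have Xe: "X i *\<^sub>v e \<in> carrier_vec (s i)" using X e by simp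
  have "\<gamma> i * (e \<bullet> (H *\<^sub>v e)) = e \<bullet> ((transpose_mat (X i) * X i) *\<^sub>v e)"
    unfolding proportional_problem_gram[OF i] using e He by (simp add: smult_mat_mult_vec[OF H e(1)])
  also have "\<dots> = e \<bullet> (transpose_mat (X i) *\<^sub>v (X i *\<^sub>v e))"
    using X e by (simp add: assoc_mult_mat_vec[of _ p "s i" _ p])
  also have "\<dots> = (X i *\<^sub>v e) \<bullet> (X i *\<^sub>v e)"
    using transpose_vec_mult_scalar[OF X e(1) Xe] comm_scalar_prod[OF e(1)] X Xe
    by (metis mult_mat_vec_carrier transpose_carrier_mat)
  finally have "0 \<le> \<gamma> i * (e \<bullet> (H *\<^sub>v e))" using real_scalar_prod_self(1)[OF Xe] by simp
  moreover have "0 < e \<bullet> (H *\<^sub>v e)" using pd e by (simp add: pos_def_mat_def)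
  ultimately show ?thesis by (simp add: zero_le_mult_iff)
qed

text \<open>Shows that zero variation is achievable for the given \<open>b\<close> and
  \<open>H\<close>, so the minimum over such problems is attained. All agents receive the same
  rescaled copy of a data matrix \<open>X m\<close> with positive weight, and zero targets.\<close>

lemma proportional_problem_homogeneous:
  assumes N: "is_matrix_norm p N" and pd: "pos_def_mat p H" and p: "p \<ge> 1"
  shows "\<exists>s' X' y' \<beta>star' \<gamma>'. proportional_problem b p H s' X' y' \<beta>star' \<gamma>' \<and>
    local_variation N b p X' y' \<beta>star' = 0"
proof -
  have H: "H \<in> carrier_mat p p" using pd by (simp add: pos_def_mat_def)
  obtain m where m: "m < b" "\<gamma> m \<noteq> 0"
    using proportional_problem_data(4) by (metis lessThan_iff sum.neutral zero_neq_one)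
  then have \<gamma>m: "\<gamma> m > 0" using proportional_problem_weight_nonneg[OF pd p m(1)] by simp
  note b = proportional_problem_data(5)
  \<comment> \<open>Chosen so that \<open>t * t * \<gamma> m = 1 / b\<close>; the Gram matrix of
    \<open>t X m\<close> is then \<open>H / b\<close>.\<close>
  define t where "t = 1 / sqrt (\<gamma> m * real b)"
  define Z where "Z = t \<cdot>\<^sub>m X m"
  have Xm: "X m \<in> carrier_mat (s m) p" by (rule proportional_problem_data(1)[OF m(1)])
  have Z: "Z \<in> carrier_mat (s m) p" using Xm by (simp add: Z_def)
  have "t * t * \<gamma> m = 1 / real b" using \<gamma>m b by (simp add: t_def)
  moreover have "transpose_mat Z * Z = (t * t) \<cdot>\<^sub>m (transpose_mat (X m) * X m)"
    using Xm by (intro eq_matI) (auto simp: Z_def smult_scalar_prod_distrib[of _ "s m"])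
  ultimately have ZZ: "transpose_mat Z * Z = (1 / real b) \<cdot>\<^sub>m H"
    unfolding proportional_problem_gram[OF m(1)] using smult_smult_mat[of "t * t" "\<gamma> m" H] by simp
  let ?X = "\<lambda>_::nat. Z" and ?y = "\<lambda>_::nat. 0\<^sub>v (s m) :: real vec"
  have hl: "hessian p (local_loss ?X ?y i) (0\<^sub>v p) = (1 / real b) \<cdot>\<^sub>m H" for i
    by (subst hessian_local_loss[where s = "s m"]) (use Z ZZ in auto)
  have hg: "hessian p (global_loss b ?X ?y) (0\<^sub>v p) = H"
  proof (rule eq_matI)
    fix k j assume "k < dim_row H" "j < dim_col H"
    then show "hessian p (global_loss b ?X ?y) (0\<^sub>v p) $$ (k, j) = H $$ (k, j)"
      using H Z b by (subst hessian_global_loss_index[where s = "\<lambda>_. s m"]) (auto simp: ZZ simp del: index_mult_mat)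
  qed (use H in \<open>auto simp: hessian_def\<close>)
  \<comment> \<open>With zero targets the nonnegative loss vanishes at the origin, which is
    therefore a minimizer.\<close>
  have "local_loss ?X ?y i (0\<^sub>v p) = 0" for i
  proof -
    have "Z *\<^sub>v 0\<^sub>v p - 0\<^sub>v (s m) = 0\<^sub>v (s m)" using Z by (intro eq_vecI) auto
    then show ?thesis by (simp add: local_loss_def)
  qed
  then have "global_loss b ?X ?y (0\<^sub>v p) = 0" by (simp add: global_loss_def)
  moreover have "0 \<le> global_loss b ?X ?y \<beta>" if "\<beta> \<in> carrier_vec p" for \<beta>
  proof -
    have "Z *\<^sub>v \<beta> - 0\<^sub>v (s m) \<in> carrier_vec (s m)" using Z that by auto
    from real_scalar_prod_self(1)[OF this] show ?thesis
      unfolding global_loss_def local_loss_def by (intro sum_nonneg) simp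
  qed
  ultimately have "is_arg_min (global_loss b ?X ?y) (\<lambda>\<beta>. \<beta> \<in> carrier_vec p) (0\<^sub>v p)"
    by (auto simp: is_arg_min_linorder)
  then have "proportional_problem b p H (\<lambda>_. s m) ?X ?y (0\<^sub>v p) (\<lambda>_. 1 / real b)"
    using Z b by (simp add: proportional_problem_def hl hg)
  moreover have "(1 / real b) \<cdot>\<^sub>m H - (1 / real b) \<cdot>\<^sub>m H = 0\<^sub>m p p" using H by (intro eq_matI) auto
  then have "local_variation N b p ?X ?y (0\<^sub>v p) = 0"
    using N by (simp add: local_variation_def hl hg is_matrix_norm_def)
  ultimately show ?thesis by blast
qed

text \<open>A vanishing sum of nonnegative norms makes every term zero, so
  \<open>\<gamma>\<^sub>i H = H / b\<close>. The weight is recovered from the entry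
  \<open>(0, 0)\<close> of \<open>H\<close>, which is positive by definiteness.\<close>

lemma zero_variation_uniform_weight:
  assumes N: "is_matrix_norm p N" and pd: "pos_def_mat p H" and p: "p \<ge> 1"
    and v: "local_variation N b p X y \<beta>star = 0" and i: "i < b"
  shows "\<gamma> i = 1 / real b"
proof -
  have H: "H \<in> carrier_mat p p" using pd by (simp add: pos_def_mat_def)
  have c: "\<gamma> i \<cdot>\<^sub>m H - (1 / real b) \<cdot>\<^sub>m H \<in> carrier_mat p p" for i using H by auto
  have "local_variation N b p X y \<beta>star = (\<Sum>i<b. N (\<gamma> i \<cdot>\<^sub>m H - (1 / real b) \<cdot>\<^sub>m H))"
    using prob by (simp add: local_variation_def proportional_problem_def)
  then have "N (\<gamma> i \<cdot>\<^sub>m H - (1 / real b) \<cdot>\<^sub>m H) = 0"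
    using v i N c by (auto simp: sum_nonneg_eq_0_iff is_matrix_norm_def)
  then have "\<gamma> i \<cdot>\<^sub>m H - (1 / real b) \<cdot>\<^sub>m H = 0\<^sub>m p p" using N c unfolding is_matrix_norm_def by blast
  from arg_cong[OF this, of "\<lambda>A. A $$ (0, 0)"] have "\<gamma> i * H $$ (0, 0) = 1 / real b * H $$ (0, 0)"
    using H p by simp
  moreover have "H $$ (0, 0) > 0"
  proof -
    have e: "unit_vec p 0 \<in> carrier_vec p" "unit_vec p 0 \<noteq> (0\<^sub>v p :: real vec)" using p by auto
    then have "0 < unit_vec p 0 \<bullet> (H *\<^sub>v unit_vec p 0)" using pd by (simp add: pos_def_mat_def)
    then show ?thesis using H p by (simp add: scalar_prod_left_unit)
  qed
  ultimately show ?thesis by (metis less_irrefl mult_right_cancel)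
qed

section \<open>FedAvg rounds as affine maps: linear part, convergence and spectral radius\<close>

lemma fedavg_affine:
  assumes H: "H \<in> carrier_mat p p"
  shows "\<exists>c. \<forall>i<b. c i \<in> carrier_vec p \<and> (\<forall>x \<in> carrier_vec p.
    local_update p h \<rho> (local_loss X y i) x = (1\<^sub>m p - (\<rho> * \<gamma> i) \<cdot>\<^sub>m H) ^\<^sub>m h *\<^sub>v x + c i)"
proof -
  have "\<exists>c. c \<in> carrier_vec p \<and> (\<forall>x \<in> carrier_vec p.
      local_update p h \<rho> (local_loss X y i) x = (1\<^sub>m p - (\<rho> * \<gamma> i) \<cdot>\<^sub>m H) ^\<^sub>m h *\<^sub>v x + c)" if i: "i < b" for i
    using local_update_affine[where X=X and y=y and i=i, OF proportional_problem_data(1)[OF i]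
        proportional_problem_data(2)[OF i] H proportional_problem_gram[OF i]] by blast
  then show ?thesis by metis
qed

text \<open>Averaging the affine local updates averages their linear parts, which is what
  \<open>M_F\<close> does, and their constants \<open>c i\<close>. The translation \<open>d\<close>
  repeats the averaged constant in every block. The round on a single vector is the special case in
  which all blocks agree.\<close>

lemma fedavg_linear_part:
  assumes H: "H \<in> carrier_mat p p"
  shows "\<exists>c \<in> carrier_vec (b * p).
    (\<forall>z \<in> carrier_vec (b * p). fedavg_stacked b p h \<rho> (local_loss X y) z = M_F b p h \<rho> H \<gamma> *\<^sub>v z + c) \<and>
    (\<forall>\<beta> \<in> carrier_vec p. kron_vec (ones_vec b) (fedavg_step b p h \<rho> (local_loss X y) \<beta>)
      = M_F b p h \<rho> H \<gamma> *\<^sub>v kron_vec (ones_vec b) \<beta> + c)"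
proof -
  obtain c where c: "\<And>i. i < b \<Longrightarrow> c i \<in> carrier_vec p"
    and up: "\<And>i x. i < b \<Longrightarrow> x \<in> carrier_vec p \<Longrightarrow>
      local_update p h \<rho> (local_loss X y i) x = (1\<^sub>m p - (\<rho> * \<gamma> i) \<cdot>\<^sub>m H) ^\<^sub>m h *\<^sub>v x + c i"
    using fedavg_affine[OF H, of h \<rho>] by blast
  define d where "d = kron_vec (ones_vec b) (server_average b p c)"
  let ?G = "\<lambda>i. (1\<^sub>m p - (\<rho> * \<gamma> i) \<cdot>\<^sub>m H) ^\<^sub>m h"
  have G: "?G i \<in> carrier_mat p p" for i by (rule pow_carrier_mat) (use H in auto)
  note M = M_F_carrier[OF H, of b h \<rho> \<gamma>]
  have d: "d \<in> carrier_vec (b * p)"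
    by (intro carrier_vecI) (simp add: d_def kron_vec_def ones_vec_def server_average_def)
  have st: "fedavg_stacked b p h \<rho> (local_loss X y) z = M_F b p h \<rho> H \<gamma> *\<^sub>v z + d"
    if z: "z \<in> carrier_vec (b * p)" for z
  proof (rule eq_vecI)
    fix k assume "k < dim_vec (M_F b p h \<rho> H \<gamma> *\<^sub>v z + d)"
    then have k: "k < b * p" using d by simp
    then have p: "p > 0" by (cases p) auto
    have k': "k div p < b" "k mod p < p" using k p by (auto simp: less_mult_imp_div_less)
    have "(M_F b p h \<rho> H \<gamma> *\<^sub>v z) $ k = 1 / real b * (\<Sum>i<b. (?G i *\<^sub>v block p z i) $ (k mod p))"
      unfolding block_def by (rule block_average_mult_vec_index[OF M G M_F_index[OF H] z k])
    moreover have "d $ k = 1 / real b * (\<Sum>i<b. c i $ (k mod p))"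
      using k k' by (simp add: d_def kron_vec_def ones_vec_def server_average_def)
    moreover have "fedavg_stacked b p h \<rho> (local_loss X y) z $ k
        = 1 / real b * (\<Sum>i<b. local_update p h \<rho> (local_loss X y i) (block p z i) $ (k mod p))"
      using k k' by (simp add: fedavg_stacked_def kron_vec_def ones_vec_def server_average_def)
    moreover have "local_update p h \<rho> (local_loss X y i) (block p z i) $ (k mod p)
        = (?G i *\<^sub>v block p z i) $ (k mod p) + c i $ (k mod p)" if "i < b" for i
      using up[OF that, of "block p z i"] c[OF that] k' by (simp add: block_def del: index_mult_mat_vec)
    ultimately show "fedavg_stacked b p h \<rho> (local_loss X y) z $ k = (M_F b p h \<rho> H \<gamma> *\<^sub>v z + d) $ k"
      using k d by (simp add: sum.distrib distrib_left add_divide_distrib del: index_mult_mat_vec)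
  qed (use d in \<open>simp add: fedavg_stacked_def kron_vec_def ones_vec_def server_average_def\<close>)
  have "kron_vec (ones_vec b) (fedavg_step b p h \<rho> (local_loss X y) \<beta>)
      = M_F b p h \<rho> H \<gamma> *\<^sub>v kron_vec (ones_vec b) \<beta> + d" if \<beta>: "\<beta> \<in> carrier_vec p" for \<beta>
  proof -
    have z: "kron_vec (ones_vec b) \<beta> \<in> carrier_vec (b * p)"
      using \<beta> by (intro carrier_vecI) (simp add: kron_vec_def ones_vec_def)
    have "block p (kron_vec (ones_vec b) \<beta>) i = \<beta>" if "i < b" for i
      using \<beta> that by (intro eq_vecI) (auto simp: block_def kron_vec_def ones_vec_def block_index_less)
    then have "fedavg_stacked b p h \<rho> (local_loss X y) (kron_vec (ones_vec b) \<beta>)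
        = kron_vec (ones_vec b) (fedavg_step b p h \<rho> (local_loss X y) \<beta>)"
      by (simp add: fedavg_stacked_def fedavg_step_def server_average_def)
    then show ?thesis using st[OF z] by simp
  qed
  then show ?thesis using d st by blast
qed

text \<open>The argument runs on the unstacked iterate: a round is affine in dimension
  \<open>p\<close> with linear part \<open>power_average\<close>, whose eigenvalues are mean
  contractions and lie in \<open>[0, 1)\<close>.\<close>

lemma fedavg_converges:
  assumes pd: "pos_def_mat p H" and p: "p \<ge> 1" and h: "h \<ge> 1" and \<rho>: "0 < \<rho>" "\<rho> < 1 / lambda_max H"
  shows "\<exists>\<beta>lim \<in> carrier_vec p. \<forall>\<beta>0 \<in> carrier_vec p. \<forall>j<p.
    (\<lambda>t. ((fedavg_step b p h \<rho> (local_loss X y) ^^ t) \<beta>0) $ j) \<longlonglongrightarrow> \<beta>lim $ j"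
proof -
  have H: "H \<in> carrier_mat p p" and sym: "transpose_mat H = H" using pd by (auto simp: pos_def_mat_def)
  note b = proportional_problem_data(5)
  obtain c where c: "\<And>i. i < b \<Longrightarrow> c i \<in> carrier_vec p"
    and up: "\<And>i x. i < b \<Longrightarrow> x \<in> carrier_vec p \<Longrightarrow>
      local_update p h \<rho> (local_loss X y i) x = (1\<^sub>m p - (\<rho> * \<gamma> i) \<cdot>\<^sub>m H) ^\<^sub>m h *\<^sub>v x + c i"
    using fedavg_affine[OF H, of h \<rho>] by blast
  define A where "A = power_average (1 / real b) (\<lambda>i. \<rho> * \<gamma> i) h H b"
  have A: "A \<in> carrier_mat p p" using H by (simp add: A_def)
  have d: "server_average b p c \<in> carrier_vec p" by (simp add: server_average_def)
  have "fedavg_step b p h \<rho> (local_loss X y) x = A *\<^sub>v x + server_average b p c"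
    if x: "x \<in> carrier_vec p" for x
  proof (rule eq_vecI)
    fix j assume "j < dim_vec (A *\<^sub>v x + server_average b p c)"
    then have j: "j < p" using d by simp
    have "local_update p h \<rho> (local_loss X y i) x $ j
        = ((1\<^sub>m p - (\<rho> * \<gamma> i) \<cdot>\<^sub>m H) ^\<^sub>m h *\<^sub>v x) $ j + c i $ j" if "i < b" for i
      using up[OF that x] c[OF that] j by (simp del: index_mult_mat_vec)
    moreover have "(A *\<^sub>v x) $ j = 1 / real b * (\<Sum>i<b. ((1\<^sub>m p - (\<rho> * \<gamma> i) \<cdot>\<^sub>m H) ^\<^sub>m h *\<^sub>v x) $ j)"
      unfolding A_def by (rule power_average_mult_vec_index[OF H x j])
    ultimately show "fedavg_step b p h \<rho> (local_loss X y) x $ j = (A *\<^sub>v x + server_average b p c) $ j"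
      using j by (simp add: fedavg_step_def server_average_def sum.distrib distrib_left add_divide_distrib del: index_mult_mat_vec)
  qed (use d in \<open>simp add: fedavg_step_def server_average_def\<close>)
  moreover have "real_spectral_radius A < 1"
  proof -
    have "map_mat complex_of_real A \<in> carrier_mat p p" using A by simp
    moreover have "p > 0" using p by simp
    ultimately obtain \<mu> where \<mu>: "eigenvalue (map_mat complex_of_real A) \<mu>" "real_spectral_radius A = cmod \<mu>"
      unfolding real_spectral_radius_def by (rule spectral_radius_witness)
    then obtain x where x: "eigenvalue H x" "\<mu> = of_real (mean_contraction b h \<rho> \<gamma> x)"
      unfolding A_def of_real_eigenvalue_power_average[OF H sym] by blast
    show ?thesis
      using mean_contraction_bounds(1,2)[OF b h \<rho>(1) pos_def_eigenvalue_bounds[OF pd \<rho> x(1)]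
          proportional_problem_weight_nonneg[OF pd p] proportional_problem_data(4)] \<mu>(2) x(2)
      by simp
  qed
  ultimately show ?thesis using affine_iteration_converges[OF A _ _ d] p by simp
qed

lemma spectral_radius_M_F_less_1:
  assumes pd: "pos_def_mat p H" and p: "p \<ge> 1" and h: "h \<ge> 1" and \<rho>: "0 < \<rho>" "\<rho> < 1 / lambda_max H"
  shows "real_spectral_radius (M_F b p h \<rho> H \<gamma>) < 1"
proof -
  have H: "H \<in> carrier_mat p p" and sym: "transpose_mat H = H" using pd by (auto simp: pos_def_mat_def)
  note b = proportional_problem_data(5)
  have M: "map_mat complex_of_real (M_F b p h \<rho> H \<gamma>) \<in> carrier_mat (b * p) (b * p)"
    using M_F_carrier[OF H] by simp
  have bp: "b * p > 0" using b p by simp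
  obtain \<mu> where \<mu>: "eigenvalue (map_mat complex_of_real (M_F b p h \<rho> H \<gamma>)) \<mu>"
    "real_spectral_radius (M_F b p h \<rho> H \<gamma>) = cmod \<mu>"
    unfolding real_spectral_radius_def by (rule spectral_radius_witness[OF M bp])
  show ?thesis
  proof (cases "\<mu> = 0")
    case False
    then obtain x where x: "eigenvalue H x" "\<mu> = of_real (mean_contraction b h \<rho> \<gamma> x)"
      using eigenvalue_M_F(1)[OF H sym b \<mu>(1)] by blast
    show ?thesis
      using mean_contraction_bounds(1,2)[OF b h \<rho>(1) pos_def_eigenvalue_bounds[OF pd \<rho> x(1)]
          proportional_problem_weight_nonneg[OF pd p] proportional_problem_data(4)] \<mu>(2) x(2)
      by simp
  qed (use \<mu> in simp)
qed

text \<open>An eigenvalue of largest modulus for uniform weights, if nonzero, comes from an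
  eigenvalue \<open>x\<close> of \<open>H\<close>. The same \<open>x\<close> yields an eigenvalue of
  \<open>M_F\<close> for the weights \<gamma>, and by Jensen it is at least as large.\<close>

lemma spectral_radius_M_F_minimal:
  assumes pd: "pos_def_mat p H" and p: "p \<ge> 1" and h: "h \<ge> 1" and \<rho>: "0 < \<rho>" "\<rho> < 1 / lambda_max H"
    and unif: "\<And>i. i < b \<Longrightarrow> \<gamma>' i = 1 / real b"
  shows "real_spectral_radius (M_F b p h \<rho> H \<gamma>') \<le> real_spectral_radius (M_F b p h \<rho> H \<gamma>)"
proof -
  have H: "H \<in> carrier_mat p p" and sym: "transpose_mat H = H" using pd by (auto simp: pos_def_mat_def)
  note b = proportional_problem_data(5)
  have M: "map_mat complex_of_real (M_F b p h \<rho> H g) \<in> carrier_mat (b * p) (b * p)" for g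
    using M_F_carrier[OF H] by simp
  have bp: "b * p > 0" using b p by simp
  obtain \<mu> where \<mu>: "eigenvalue (map_mat complex_of_real (M_F b p h \<rho> H \<gamma>')) \<mu>"
    "real_spectral_radius (M_F b p h \<rho> H \<gamma>') = cmod \<mu>"
    unfolding real_spectral_radius_def by (rule spectral_radius_witness[OF M bp])
  have ge: "cmod \<nu> \<le> real_spectral_radius (M_F b p h \<rho> H \<gamma>)"
    if "eigenvalue (map_mat complex_of_real (M_F b p h \<rho> H \<gamma>)) \<nu>" for \<nu>
    using cmod_le_spectral_radius[OF M bp that] by (simp add: real_spectral_radius_def)
  show ?thesis
  proof (cases "\<mu> = 0")
    case True
    \<comment> \<open>Any eigenvalue shows that the right-hand spectral radius is nonnegative, which
      suffices when the left one is 0.\<close>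
    obtain \<nu> where "eigenvalue (map_mat complex_of_real (M_F b p h \<rho> H \<gamma>)) \<nu>"
      by (rule spectral_radius_witness[OF M bp])
    then show ?thesis using order_trans[OF norm_ge_zero ge] \<mu>(2) True by simp
  next
    case False
    then obtain x where x: "eigenvalue H x" "\<mu> = of_real (mean_contraction b h \<rho> \<gamma>' x)"
      using eigenvalue_M_F(1)[OF H sym b \<mu>(1)] by blast
    note B = mean_contraction_bounds[OF b h \<rho>(1) pos_def_eigenvalue_bounds[OF pd \<rho> x(1)]
          proportional_problem_weight_nonneg[OF pd p] proportional_problem_data(4)]
    have "mean_contraction b h \<rho> \<gamma>' x = (1 - \<rho> * x / real b) ^ h"
      using b unif by (simp add: mean_contraction_def)
    then have "cmod \<mu> = (1 - \<rho> * x / real b) ^ h"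
      unfolding x(2) norm_of_real by (simp only: abs_of_nonneg[OF zero_le_power[OF B(4)]])
    then have "cmod \<mu> \<le> mean_contraction b h \<rho> \<gamma> x" using B(3) by simp
    also have "\<dots> \<le> real_spectral_radius (M_F b p h \<rho> H \<gamma>)"
      using ge[OF eigenvalue_M_F(2)[OF H sym b x(1)]] B(2) by simp
    finally show ?thesis using \<mu>(2) by simp
  qed
qed

end

theorem proposition3p1:
  fixes b p h :: nat and \<rho> :: real and H :: "real Matrix.mat" and N :: "real Matrix.mat \<Rightarrow> real"
    and s :: "nat \<Rightarrow> nat" and X :: "nat \<Rightarrow> real Matrix.mat" and y :: "nat \<Rightarrow> real Matrix.vec"
    and \<beta>star :: "real Matrix.vec" and \<gamma> :: "nat \<Rightarrow> real"
  assumes "p \<ge> 1" and "h \<ge> 1" and "\<rho> > 0"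
    and "is_matrix_norm p N"
    and "pos_def_mat p H"
    and "\<rho> < 1 / lambda_max H"
    and "proportional_problem b p H s X y \<beta>star \<gamma>"
  shows
    "(\<exists>c \<in> carrier_vec (b * p).
        (\<forall>z \<in> carrier_vec (b * p).
           fedavg_stacked b p h \<rho> (local_loss X y) z = M_F b p h \<rho> H \<gamma> *\<^sub>v z + c) \<and>
        (\<forall>\<beta> \<in> carrier_vec p.
           kron_vec (ones_vec b) (fedavg_step b p h \<rho> (local_loss X y) \<beta>)
             = M_F b p h \<rho> H \<gamma> *\<^sub>v kron_vec (ones_vec b) \<beta> + c))
     \<and> (\<exists>\<beta>lim \<in> carrier_vec p. \<forall>\<beta>0 \<in> carrier_vec p. \<forall>j<p.
          (\<lambda>t. vec_index ((fedavg_step b p h \<rho> (local_loss X y) ^^ t) \<beta>0) j)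
            \<longlonglongrightarrow> vec_index \<beta>lim j)
     \<and> real_spectral_radius (M_F b p h \<rho> H \<gamma>) < 1
     \<and> (\<exists>s' X' y' \<beta>star' \<gamma>'. proportional_problem b p H s' X' y' \<beta>star' \<gamma>' \<and>
          local_variation N b p X' y' \<beta>star' = 0)
     \<and> (\<forall>s' X' y' \<beta>star' \<gamma>'. proportional_problem b p H s' X' y' \<beta>star' \<gamma>' \<and>
          local_variation N b p X' y' \<beta>star' = 0 \<longrightarrow>
          real_spectral_radius (M_F b p h \<rho> H \<gamma>') \<le> real_spectral_radius (M_F b p h \<rho> H \<gamma>))"
proof (intro conjI allI impI)
  have H: "H \<in> carrier_mat p p" using assms(5) by (simp add: pos_def_mat_def)
  note prem = assms(5,1,2,3,6)
  show "\<exists>c \<in> carrier_vec (b * p).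
        (\<forall>z \<in> carrier_vec (b * p).
           fedavg_stacked b p h \<rho> (local_loss X y) z = M_F b p h \<rho> H \<gamma> *\<^sub>v z + c) \<and>
        (\<forall>\<beta> \<in> carrier_vec p.
           kron_vec (ones_vec b) (fedavg_step b p h \<rho> (local_loss X y) \<beta>)
             = M_F b p h \<rho> H \<gamma> *\<^sub>v kron_vec (ones_vec b) \<beta> + c)"
    by (rule fedavg_linear_part[OF assms(7) H])
  show "\<exists>\<beta>lim \<in> carrier_vec p. \<forall>\<beta>0 \<in> carrier_vec p. \<forall>j<p.
      (\<lambda>t. vec_index ((fedavg_step b p h \<rho> (local_loss X y) ^^ t) \<beta>0) j) \<longlonglongrightarrow> vec_index \<beta>lim j"
    by (rule fedavg_converges[OF assms(7) prem])
  show "real_spectral_radius (M_F b p h \<rho> H \<gamma>) < 1"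
    by (rule spectral_radius_M_F_less_1[OF assms(7) prem])
  show "\<exists>s' X' y' \<beta>star' \<gamma>'. proportional_problem b p H s' X' y' \<beta>star' \<gamma>' \<and>
      local_variation N b p X' y' \<beta>star' = 0"
    by (rule proportional_problem_homogeneous[OF assms(7,4,5,1)])
  fix s' X' y' \<beta>star' \<gamma>'
  assume "proportional_problem b p H s' X' y' \<beta>star' \<gamma>' \<and> local_variation N b p X' y' \<beta>star' = 0"
  \<comment> \<open>Zero variation makes the competing weights uniform, which reduces the comparison
    to the Jensen bound.\<close>
  then have "\<gamma>' i = 1 / real b" if "i < b" for i
    using zero_variation_uniform_weight[OF _ assms(4,5,1) _ that] by blast
  then show "real_spectral_radius (M_F b p h \<rho> H \<gamma>') \<le> real_spectral_radius (M_F b p h \<rho> H \<gamma>)"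
    by (rule spectral_radius_M_F_minimal[OF assms(7) prem])
qed

end
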